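(* Let $G=(V,E)$ be a finite simple undirected graph with edge weights $w\in\mathbb{R}_{\ge 0}^E$, and run a version of Edmonds' weighted perfect matching algorithm (as described in the context) satisfying the following condition: initially $\pi(U)=0$ for all $U$ with $|U|\ge3$ and $\pi(\{v\})=\beta$ for all $v\in V$, for some fixed $\beta\in\mathbb{R}$; and in every dual update step, the values $\pi(U)$ are increased by the same amount for all $U\in\mathcal{T}$ whose values are increased. Then every matching $\widetilde{M}$ of $G$ constructed during the algorithm is cardinality-optimal, i.e. $\sum_{e\in\widetilde{M}}w_e\le\sum_{e\in N}w_e$ for every matching $N$ of $G$ with $|N|=|\widetilde{M}|$.
   Context: Notation: $\mathcal{O}$ is the family of odd-cardinality subsets of $V$; for $U\subseteq V$, $\delta(U)$ is the set of edges with exactly one end in $U$ and $E[U]$ the set of edges with both ends in $U$. A family is laminar if any two members are disjoint or nested. Edmonds' algorithm (primal–dual version). The algorithm maintains: a laminar family $\Omega\subseteq\mathcal{O}$ containing all singletons; dual values $\pi:\mathcal{O}\to\mathbb{R}$ with $\pi(U)=0$ for $U\notin\Omega$, always satisfying (a) $\pi(U)\ge 0$ for all $U$ with $|U|\ge 3$ and (b) $\sum_{U:\,e\in\delta(U)}\pi(U)\le w_e$ for all $e\in E$; and a matching $M$ in the auxiliary graph $G'$, obtained from $G$ by deleting all edges for which (b) is strict and contracting each inclusion-wise maximal set of $\Omega$ (these sets, $\Omega_{\max}$, partition $V$) to a single node. Every $U\in\Omega$ with $|U|\ge3$ was created by shrinking a blossom (an odd cycle of $G'$); the algorithm correspondingly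 maintains a matching $\widetilde{M}$ of $G$ (obtained from $M$ by iteratively deshrinking the sets of $\Omega_{\max}$, using inside each blossom the near-perfect matching recorded for it and updated along even alternating paths of its cycle when an augmenting path passes through it) whose edges between distinct sets of $\Omega_{\max}$ are exactly the edges of $M$. Initially $M=\emptyset$, $\Omega$ consists of the singletons, and $\pi$ is a feasible initial dual supported on singletons. Each iteration: let $X$ be the set of nodes of $G'$ not covered by $M$. If $X=\emptyset$, stop. If $G'$ has an $M$-alternating walk between two nodes of $X$, take a shortest one; if it is a path, augment $M$ (and $\widetilde{M}$) along it; otherwise it contains a blossom, whose union $U$ of original nodes is added to $\Omega$ with $\pi(U)=0$ (shrinking). Otherwise, let $\mathcal{T}$ be the set of nodes of $G'$ reachable from $X$ by an even-length $M$-alternating path (including $X$) and $\mathcal{S}$ those reachable by an odd-length one; increase the duals $\pi(U)$ of (some of) the sets $U\in\mathcal{T}$ and decrease those of the corresponding sets in $\mathcal{S}$ as far as (a) and (b) permit (the basic version uses one common amount $\alpha$ for all of $\mathcal{T}\cup\mathcal{S}$; variants may use different amounts on different alternating trees). If the change can be arbitrarily large, stop and assert that $G$ has no perfect matching. Finally, every $U\in\Omega_{\max}$ with $|U|\ge 3$ and $\pi(U)=0$ is removed from $\Omega$ (deshrinking).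
   Formalization: In each dual update all sets U in T are required to change by one common amount, not only those whose values are increased; raising only some of T fails (E={ab,cd}, w(ab)=10, w(cd)=1, β=0, raise only π({a}) by 10, then augment along ab). *)

theory Defs
  imports Complex_Main
begin

definition simple_graph :: "'v set \<Rightarrow> 'v set set \<Rightarrow> bool" where
  "simple_graph V E \<longleftrightarrow> finite V \<and> (\<forall>e\<in>E. e \<subseteq> V \<and> card e = 2)"

definition matching :: "'v set set \<Rightarrow> 'v set set \<Rightarrow> bool" where
  "matching E M \<longleftrightarrow> M \<subseteq> E \<and> pairwise disjnt M"

definition cardinality_optimal :: "'v set set \<Rightarrow> ('v set \<Rightarrow> real) \<Rightarrow> 'v set set \<Rightarrow> bool" where
  "cardinality_optimal E w M \<longleftrightarrow>
     matching E M \<and> (\<forall>N. matching E N \<and> card N = card M \<longrightarrow> sum w M \<le> sum w N)"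

definition odd_sets :: "'v set \<Rightarrow> 'v set set" where
  "odd_sets V = {U. U \<subseteq> V \<and> odd (card U)}"

definition cut :: "'v set set \<Rightarrow> 'v set \<Rightarrow> 'v set set" where
  "cut E U = {e\<in>E. card (e \<inter> U) = 1}"

definition dual_load :: "'v set \<Rightarrow> 'v set set \<Rightarrow> ('v set \<Rightarrow> real) \<Rightarrow> 'v set \<Rightarrow> real" where
  "dual_load V E y e = (\<Sum>U | U \<in> odd_sets V \<and> e \<in> cut E U. y U)"

definition dual_feasible ::
  "'v set \<Rightarrow> 'v set set \<Rightarrow> ('v set \<Rightarrow> real) \<Rightarrow> ('v set \<Rightarrow> real) \<Rightarrow> bool" where
  "dual_feasible V E w y \<longleftrightarrow>
     (\<forall>U\<in>odd_sets V. 3 \<le> card U \<longrightarrow> 0 \<le> y U) \<and> (\<forall>e\<in>E. dual_load V E y e \<le> w e)"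

definition maximal_sets :: "'v set set \<Rightarrow> 'v set set" where
  "maximal_sets F = {U\<in>F. \<forall>W\<in>F. \<not> U \<subset> W}"

definition uncovered :: "'v set set \<Rightarrow> 'v set \<Rightarrow> bool" where
  "uncovered M U \<longleftrightarrow> (\<forall>e\<in>M. e \<inter> U = {})"

text \<open>
  Contracted graphs are given by a family \<open>\<N>\<close> of pairwise disjoint vertex sets (the nodes) and a set
  \<open>F\<close> of edges of the original graph. Edges keep their identity under contraction, so a walk is given
  by its nodes together with its edges; this accounts for parallel edges. An edge inside a single
  node (a loop) is never used.
\<close>

definition walk :: "'v set set \<Rightarrow> 'v set set \<Rightarrow> 'v set list \<Rightarrow> 'v set list \<Rightarrow> bool" where
  "walk \<N> F Us es \<longleftrightarrow>
     length Us = Suc (length es) \<and> set Us \<subseteq> \<N> \<and> set es \<subseteq> F \<and>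
     (\<forall>i<length es. Us ! i \<noteq> Us ! Suc i \<and> es ! i \<inter> Us ! i \<noteq> {} \<and> es ! i \<inter> Us ! Suc i \<noteq> {})"

definition alternating :: "'v set set \<Rightarrow> 'v set list \<Rightarrow> bool" where
  "alternating M es \<longleftrightarrow> (\<forall>i. Suc i < length es \<longrightarrow> (es ! i \<in> M) \<noteq> (es ! Suc i \<in> M))"

text \<open>
  State of the algorithm: the laminar family \<open>\<Omega>\<close> (\<open>family\<close>), the dual values \<open>\<pi>\<close> (\<open>dual\<close>), the
  matching \<open>M\<close> of the contracted graph (\<open>cmatch\<close>, as a set of edges of the original graph), and, for
  each blossom \<open>U\<close> of the family, the edges of the odd cycle that was shrunk (\<open>cycle\<close>) and the
  recorded near-perfect matching of this cycle (\<open>near\<close>). The values of \<open>cycle\<close> and \<open>near\<close> at sets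
  that are not blossoms of the family are irrelevant.
\<close>

record 'v state =
  family :: "'v set set"
  dual :: "'v set \<Rightarrow> real"
  cmatch :: "'v set set"
  cycle :: "'v set \<Rightarrow> 'v set set"
  near :: "'v set \<Rightarrow> 'v set set"

definition blossoms :: "'v state \<Rightarrow> 'v set set" where
  "blossoms s = {U \<in> family s. 3 \<le> card U}"

text \<open>Deshrinking \<open>U\<close> adds \<open>near s U\<close> to the matching; deshrinking everything gives \<open>M\<close> with a tilde.\<close>

definition full_matching :: "'v state \<Rightarrow> 'v set set" where
  "full_matching s = cmatch s \<union> \<Union> (near s ` blossoms s)"

definition nodes :: "'v state \<Rightarrow> 'v set set" where
  "nodes s = maximal_sets (family s)"

text \<open>The nodes of the cycle that was shrunk to the blossom \<open>U\<close>.\<close>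

definition cycle_nodes :: "'v state \<Rightarrow> 'v set \<Rightarrow> 'v set set" where
  "cycle_nodes s U = maximal_sets {W \<in> family s. W \<subset> U}"

definition tight_edges ::
  "'v set \<Rightarrow> 'v set set \<Rightarrow> ('v set \<Rightarrow> real) \<Rightarrow> 'v state \<Rightarrow> 'v set set" where
  "tight_edges V E w s = {e\<in>E. dual_load V E (dual s) e = w e}"

definition exposed_nodes :: "'v state \<Rightarrow> 'v set set" where
  "exposed_nodes s = {U \<in> nodes s. uncovered (cmatch s) U}"

definition alt_walk ::
  "'v set \<Rightarrow> 'v set set \<Rightarrow> ('v set \<Rightarrow> real) \<Rightarrow> 'v state \<Rightarrow> 'v set list \<Rightarrow> 'v set list \<Rightarrow> bool" where
  "alt_walk V E w s Us es \<longleftrightarrow> walk (nodes s) (tight_edges V E w s) Us es \<and> alternating (cmatch s) es"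

text \<open>The two end nodes may coincide, so that a blossom through an exposed node is found.\<close>

definition exposed_walk ::
  "'v set \<Rightarrow> 'v set set \<Rightarrow> ('v set \<Rightarrow> real) \<Rightarrow> 'v state \<Rightarrow> 'v set list \<Rightarrow> 'v set list \<Rightarrow> bool" where
  "exposed_walk V E w s Us es \<longleftrightarrow>
     alt_walk V E w s Us es \<and> es \<noteq> [] \<and> hd Us \<in> exposed_nodes s \<and> last Us \<in> exposed_nodes s"

definition shortest_exposed_walk ::
  "'v set \<Rightarrow> 'v set set \<Rightarrow> ('v set \<Rightarrow> real) \<Rightarrow> 'v state \<Rightarrow> 'v set list \<Rightarrow> 'v set list \<Rightarrow> bool" where
  "shortest_exposed_walk V E w s Us es \<longleftrightarrow>
     exposed_walk V E w s Us es \<and>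
     (\<forall>Us' es'. exposed_walk V E w s Us' es' \<longrightarrow> length es \<le> length es')"

definition outer_nodes ::
  "'v set \<Rightarrow> 'v set set \<Rightarrow> ('v set \<Rightarrow> real) \<Rightarrow> 'v state \<Rightarrow> 'v set set" where
  "outer_nodes V E w s =
     {U. \<exists>Us es. alt_walk V E w s Us es \<and> distinct Us \<and> even (length es) \<and>
                 hd Us \<in> exposed_nodes s \<and> last Us = U}"

definition inner_nodes ::
  "'v set \<Rightarrow> 'v set set \<Rightarrow> ('v set \<Rightarrow> real) \<Rightarrow> 'v state \<Rightarrow> 'v set set" where
  "inner_nodes V E w s =
     {U. \<exists>Us es. alt_walk V E w s Us es \<and> distinct Us \<and> odd (length es) \<and>
                 hd Us \<in> exposed_nodes s \<and> last Us = U}"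

text \<open>Edge sets of even alternating paths in the cycle of \<open>U\<close>, starting at the node missed by \<open>near s U\<close>.\<close>

definition even_cycle_path :: "'v state \<Rightarrow> 'v set \<Rightarrow> 'v set set \<Rightarrow> bool" where
  "even_cycle_path s U Q \<longleftrightarrow>
     (\<exists>Us es. walk (cycle_nodes s U) (cycle s U) Us es \<and> alternating (near s U) es \<and>
              distinct Us \<and> even (length es) \<and> uncovered (near s U) (hd Us) \<and> Q = set es)"

text \<open>
  Inside the nodes of the augmenting path, the matching of each blossom \<open>U\<close> is switched along an even
  alternating path of its cycle (with no edges if the augmenting path does not change the vertex of
  \<open>U\<close> that is matched outside \<open>U\<close>). The last condition determines where this path ends: if the new
  matching contains an edge leaving \<open>U\<close>, then \<open>near s' U\<close> misses the node of the cycle at which that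
  edge ends.
\<close>

definition augment_step ::
  "'v set \<Rightarrow> 'v set set \<Rightarrow> ('v set \<Rightarrow> real) \<Rightarrow> 'v state \<Rightarrow> 'v state \<Rightarrow> bool" where
  "augment_step V E w s s' \<longleftrightarrow>
     (\<exists>Us es N. shortest_exposed_walk V E w s Us es \<and> distinct Us \<and>
        s' = s\<lparr>cmatch := sym_diff (cmatch s) (set es), near := N\<rparr> \<and>
        (\<forall>U. U \<in> blossoms s \<and> (\<exists>B\<in>set Us. U \<subseteq> B) \<longrightarrow>
             (\<exists>Q. even_cycle_path s U Q \<and> N U = sym_diff (near s U) Q)) \<and>
        (\<forall>U. \<not> (U \<in> blossoms s \<and> (\<exists>B\<in>set Us. U \<subseteq> B)) \<longrightarrow> N U = near s U) \<and>
        (\<forall>U\<in>blossoms s. \<forall>e \<in> full_matching s' \<inter> cut E U. \<forall>W\<in>cycle_nodes s U.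
             e \<inter> W \<noteq> {} \<longrightarrow> uncovered (N U) W))"

definition shrink_step ::
  "'v set \<Rightarrow> 'v set set \<Rightarrow> ('v set \<Rightarrow> real) \<Rightarrow> 'v state \<Rightarrow> 'v state \<Rightarrow> bool" where
  "shrink_step V E w s s' \<longleftrightarrow>
     (\<exists>Us es i j. shortest_exposed_walk V E w s Us es \<and> \<not> distinct Us \<and>
        i < j \<and> j < length Us \<and> Us ! i = Us ! j \<and> odd (j - i) \<and>
        distinct (take (j - i) (drop i Us)) \<and>
        (let U = \<Union> (set (take (j - i) (drop i Us)));
             C = set (take (j - i) (drop i es))
         in s' = s\<lparr>family := insert U (family s), dual := (dual s)(U := 0),
                  cmatch := cmatch s - C,
                  cycle := (cycle s)(U := C), near := (near s)(U := cmatch s \<inter> C)\<rparr>))"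

text \<open>
  A partition of the outer and inner nodes into alternating trees rooted at the exposed nodes;
  \<open>r U\<close> is the root of the tree containing \<open>U\<close>.
\<close>

definition alternating_trees ::
  "'v set \<Rightarrow> 'v set set \<Rightarrow> ('v set \<Rightarrow> real) \<Rightarrow> 'v state \<Rightarrow> ('v set \<Rightarrow> 'v set) \<Rightarrow> bool" where
  "alternating_trees V E w s r \<longleftrightarrow>
     (\<forall>U \<in> outer_nodes V E w s \<union> inner_nodes V E w s.
        r U \<in> exposed_nodes s \<and>
        (\<exists>Us es. alt_walk V E w s Us es \<and> distinct Us \<and> hd Us = r U \<and> last Us = U \<and>
                 (\<forall>W\<in>set Us. r W = r U)))"

definition shifted_dual ::
  "'v set \<Rightarrow> 'v set set \<Rightarrow> ('v set \<Rightarrow> real) \<Rightarrow> 'v state \<Rightarrow> ('v set \<Rightarrow> real) \<Rightarrow> 'v set \<Rightarrow> real" where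
  "shifted_dual V E w s a U =
     (if U \<in> outer_nodes V E w s then dual s U + a U
      else if U \<in> inner_nodes V E w s then dual s U - a U
      else dual s U)"

text \<open>
  The amount may depend on the alternating tree: \<open>d\<close> gives the relative amounts for the roots (zero
  for trees that are not changed), and the change \<open>\<alpha> * d\<close> is made as large as feasibility permits.
  There is no successor state if the change can be arbitrarily large. The blossoms whose dual value
  has become zero are deshrunk, which does not change the matching of the original graph.
\<close>

definition dual_step ::
  "'v set \<Rightarrow> 'v set set \<Rightarrow> ('v set \<Rightarrow> real) \<Rightarrow> 'v state \<Rightarrow> 'v state \<Rightarrow> bool" where
  "dual_step V E w s s' \<longleftrightarrow>
     (\<nexists>Us es. exposed_walk V E w s Us es) \<and>
     (\<exists>r d \<alpha>. alternating_trees V E w s r \<and>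
        (\<forall>x\<in>exposed_nodes s. 0 \<le> d x) \<and> (\<exists>x\<in>exposed_nodes s. 0 < d x) \<and> 0 \<le> \<alpha> \<and>
        dual_feasible V E w (shifted_dual V E w s (\<lambda>U. \<alpha> * d (r U))) \<and>
        (\<forall>\<alpha>'>\<alpha>. \<not> dual_feasible V E w (shifted_dual V E w s (\<lambda>U. \<alpha>' * d (r U)))) \<and>
        (let y = shifted_dual V E w s (\<lambda>U. \<alpha> * d (r U));
             D = {U \<in> nodes s. 3 \<le> card U \<and> y U = 0}
         in s' = s\<lparr>family := family s - D, dual := y, cmatch := cmatch s \<union> \<Union> (near s ` D)\<rparr>))"

definition edmonds_init ::
  "'v set \<Rightarrow> 'v set set \<Rightarrow> ('v set \<Rightarrow> real) \<Rightarrow> 'v state \<Rightarrow> bool" where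
  "edmonds_init V E w s \<longleftrightarrow>
     family s = (\<lambda>v. {v}) ` V \<and> cmatch s = {} \<and>
     (\<forall>U. U \<notin> family s \<longrightarrow> dual s U = 0) \<and> dual_feasible V E w (dual s)"

definition edmonds_iteration ::
  "'v set \<Rightarrow> 'v set set \<Rightarrow> ('v set \<Rightarrow> real) \<Rightarrow> 'v state \<Rightarrow> 'v state \<Rightarrow> bool" where
  "edmonds_iteration V E w s s' \<longleftrightarrow>
     exposed_nodes s \<noteq> {} \<and>
     (augment_step V E w s s' \<or> shrink_step V E w s s' \<or> dual_step V E w s s')"

definition edmonds_run ::
  "'v set \<Rightarrow> 'v set set \<Rightarrow> ('v set \<Rightarrow> real) \<Rightarrow> (nat \<Rightarrow> 'v state) \<Rightarrow> nat \<Rightarrow> bool" where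
  "edmonds_run V E w s n \<longleftrightarrow>
     edmonds_init V E w (s 0) \<and> (\<forall>i<n. edmonds_iteration V E w (s i) (s (Suc i)))"

end

theory Submission
  imports Defs
begin

text \<open>
  Let \<open>y v\<close> be the sum of the dual values of the odd sets containing \<open>v\<close>. A dual update changes every
  \<open>y v\<close> by at most the common amount \<open>\<delta>\<close>, and by exactly \<open>\<delta>\<close> if \<open>v\<close> is exposed, because the maximal
  set containing an exposed vertex is exposed and hence outer. Since all \<open>y v\<close> are equal at the start and
  no covered vertex is ever exposed again, the exposed vertices always attain the maximum \<open>c\<close> of \<open>y\<close>.

  Summing the loads of the edges of a matching \<open>N\<close> gives the sum of \<open>y\<close> over the vertices covered by
  \<open>N\<close> minus twice the sum over \<open>U\<close> of \<open>\<pi>(U) |N \<inter> E[U]|\<close>. Among all matchings of the same cardinality this is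
  smallest for the matching of the algorithm: it leaves uncovered only vertices with \<open>y v = c\<close> and
  it is near-perfect inside every set of the family. As it uses tight edges only, it is optimal.
\<close>

text \<open>The matching of G is stored in pieces, \<open>cmatch\<close> on the maximal sets and one
  \<open>near\<close> per blossom. That the pieces form a matching, and one that is near-perfect in
  every member of the family, is derived from a single link between nesting levels: an edge of the
  full matching that leaves a blossom ends in a cycle node missed by its \<open>near\<close>. The
  same link shows that an exposed vertex lies in an exposed maximal set, since an edge entering a
  set must hit its only vertex not covered from inside. Later augmentations switch to other edges of
  a shrunk cycle, and deshrinking returns them to the contracted graph; hence all cycle edges must
  stay tight. They do, because dual updates change maximal sets only. For an edge of
  \<open>cmatch\<close> the changes must cancel: the partner of an outer node is inner and vice
  versa, and both change by the same amount, because an inner node moves by the amount of its tree's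
  root, which is itself outer. Values of singletons may be negative. This is harmless, as no edge
  lies inside a singleton.\<close>

definition laminar :: "'v set set \<Rightarrow> bool" where
  "laminar F \<longleftrightarrow> (\<forall>A\<in>F. \<forall>B\<in>F. A \<inter> B = {} \<or> A \<subseteq> B \<or> B \<subseteq> A)"

text \<open>A matching in a contracted graph whose edges are still edges of the original graph: no
  loops, and at most one edge at each node. The node family is a parameter because the notion is
  applied both to \<open>nodes\<close> with \<open>cmatch\<close> and to \<open>cycle_nodes\<close>
  with \<open>near\<close>.\<close>

definition node_matching :: "'v set set \<Rightarrow> 'v set set \<Rightarrow> bool" where
  "node_matching \<N> M \<longleftrightarrow>
     (\<forall>B\<in>\<N>. (\<forall>e\<in>M. \<not> e \<subseteq> B) \<and> (\<forall>e\<in>M. \<forall>f\<in>M. e \<inter> B \<noteq> {} \<longrightarrow> f \<inter> B \<noteq> {} \<longrightarrow> e = f))"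

lemma node_matching_unique:
  "node_matching \<N> M \<Longrightarrow> B \<in> \<N> \<Longrightarrow> e \<in> M \<Longrightarrow> f \<in> M \<Longrightarrow> e \<inter> B \<noteq> {} \<Longrightarrow> f \<inter> B \<noteq> {} \<Longrightarrow> e = f"
  unfolding node_matching_def by blast

lemma node_matching_not_inside: "node_matching \<N> M \<Longrightarrow> B \<in> \<N> \<Longrightarrow> e \<in> M \<Longrightarrow> \<not> e \<subseteq> B"
  unfolding node_matching_def by blast

lemma node_matching_mono: "node_matching \<N> M \<Longrightarrow> \<N>' \<subseteq> \<N> \<Longrightarrow> M' \<subseteq> M \<Longrightarrow> node_matching \<N>' M'"
  unfolding node_matching_def by (meson subsetD)

section \<open>Maximal members of laminar families, and edges meeting disjoint sets\<close>

lemma maximal_sets_disjoint: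
  assumes "laminar F" shows "pairwise disjnt (maximal_sets F)"
proof (rule pairwiseI)
  fix A B assume "A \<in> maximal_sets F" "B \<in> maximal_sets F" "A \<noteq> B"
  then have "A \<in> F" "B \<in> F" "\<not> A \<subseteq> B" "\<not> B \<subseteq> A" by (auto simp: maximal_sets_def psubset_eq)
  then show "disjnt A B" using assms unfolding laminar_def disjnt_def by blast
qed

lemma maximal_superset:
  assumes "finite F" "U \<in> F"
  obtains B where "B \<in> maximal_sets F" "U \<subseteq> B"
proof -
  obtain B where "B \<in> F" "U \<subseteq> B" "\<forall>W\<in>F. B \<subseteq> W \<longrightarrow> B = W" using finite_has_maximal2[OF assms] by auto
  then show thesis using that[of B] by (auto simp: maximal_sets_def psubset_eq)
qed

lemma edge_meets_disjoint:
  assumes "card e = 2" "A \<inter> B = {}" "e \<inter> A \<noteq> {}" "e \<inter> B \<noteq> {}"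
  shows "card (e \<inter> A) = 1" "e \<subseteq> A \<union> B"
proof -
  obtain x y where e: "e = {x, y}" "x \<noteq> y" using assms(1) by (auto simp: card_2_iff)
  have "x \<in> A \<and> y \<in> B \<and> x \<notin> B \<and> y \<notin> A \<or> y \<in> A \<and> x \<in> B \<and> y \<notin> B \<and> x \<notin> A"
    using assms e by auto
  then have "(e \<inter> A = {x} \<or> e \<inter> A = {y}) \<and> e \<subseteq> A \<union> B" using e by auto
  then show "card (e \<inter> A) = 1" "e \<subseteq> A \<union> B" by auto
qed

lemma edge_crosses:
  assumes "card e = 2" "e \<inter> A \<noteq> {}" "\<not> e \<subseteq> A"
  shows "card (e \<inter> A) = 1"
proof -
  have "e \<inter> - A \<noteq> {}" using assms(3) by blast
  then show ?thesis using edge_meets_disjoint(1)[OF assms(1) _ assms(2), of "- A"] by blast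
qed

section \<open>Alternating walks in contracted graphs\<close>

lemma walk_length: "walk \<N> F Us es \<Longrightarrow> length Us = Suc (length es)"
  by (simp add: walk_def)

lemma walk_node_in: "walk \<N> F Us es \<Longrightarrow> i \<le> length es \<Longrightarrow> Us ! i \<in> \<N>"
  unfolding walk_def by (metis le_imp_less_Suc nth_mem subsetD)

lemma walk_edge_in: "walk \<N> F Us es \<Longrightarrow> i < length es \<Longrightarrow> es ! i \<in> F"
  unfolding walk_def by (metis nth_mem subsetD)

lemma walk_edge_ends:
  assumes "walk \<N> F Us es" "i < length es"
  shows "Us ! i \<noteq> Us ! Suc i" "es ! i \<inter> Us ! i \<noteq> {}" "es ! i \<inter> Us ! Suc i \<noteq> {}"
  using assms by (simp_all add: walk_def)

lemma walk_hd: "walk \<N> F Us es \<Longrightarrow> hd Us = Us ! 0"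
  using walk_length hd_conv_nth[of Us] by (metis list.size(3) nat.distinct(1))

lemma walk_last: "walk \<N> F Us es \<Longrightarrow> last Us = Us ! length es"
  using walk_length last_conv_nth[of Us] by (metis diff_Suc_1 list.size(3) nat.distinct(1))

lemma walk_rev:
  assumes "walk \<N> F Us es" shows "walk \<N> F (rev Us) (rev es)"
proof -
  have "rev Us ! i \<noteq> rev Us ! Suc i \<and> rev es ! i \<inter> rev Us ! i \<noteq> {} \<and> rev es ! i \<inter> rev Us ! Suc i \<noteq> {}"
    if i: "i < length es" for i
  proof -
    define j where "j = length es - Suc i"
    have j: "j < length es" "length es - i = Suc j" using i by (auto simp: j_def)
    have "rev Us ! i = Us ! Suc j" "rev Us ! Suc i = Us ! j" "rev es ! i = es ! j"
      using i j walk_length[OF assms] by (auto simp: rev_nth j_def)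
    then show ?thesis using walk_edge_ends[OF assms j(1)] by simp
  qed
  then show ?thesis using assms by (simp add: walk_def)
qed

lemma walk_append:
  assumes "walk \<N> F Us es" "walk \<N> F Us' es'" "last Us = hd Us'"
  shows "walk \<N> F (Us @ tl Us') (es @ es')"
proof -
  have l: "length Us = Suc (length es)" "length Us' = Suc (length es')"
    using assms walk_length by blast+
  have nth: "(Us @ tl Us') ! (length es + j) = Us' ! j" if "j \<le> length es'" for j
  proof (cases j)
    case 0
    then show ?thesis using l assms(3) walk_last[OF assms(1)] walk_hd[OF assms(2)]
      by (simp add: nth_append)
  next
    case (Suc k)
    then show ?thesis using l that by (simp add: nth_append nth_tl)
  qed
  have "(Us @ tl Us') ! i \<noteq> (Us @ tl Us') ! Suc i \<and> (es @ es') ! i \<inter> (Us @ tl Us') ! i \<noteq> {} \<and>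
        (es @ es') ! i \<inter> (Us @ tl Us') ! Suc i \<noteq> {}"
    if i: "i < length (es @ es')" for i
  proof (cases "i < length es")
    case True
    then show ?thesis using walk_edge_ends[OF assms(1) True] l by (simp add: nth_append)
  next
    case False
    then obtain j where j: "i = length es + j" "j < length es'"
      using i by (metis add_less_cancel_left le_Suc_ex length_append not_le)
    then show ?thesis using walk_edge_ends[OF assms(2) j(2)] nth[of j] nth[of "Suc j"]
      by (simp add: nth_append)
  qed
  moreover have "set (tl Us') \<subseteq> set Us'" by (cases Us') auto
  ultimately show ?thesis using assms(1,2) l by (auto simp: walk_def)
qed

lemma walk_butlast:
  assumes "walk \<N> F Us es" "es \<noteq> []"
  shows "walk \<N> F (butlast Us) (butlast es)"
  using assms unfolding walk_def
  by (auto simp: nth_butlast dest: in_set_butlastD)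

text \<open>The two consecutive nodes are distinct members of a disjoint family and each contains an
  end of the edge, so no end is left for a third node.\<close>

lemma walk_edge_hits:
  assumes \<N>: "pairwise disjnt \<N>" and F: "\<forall>e\<in>F. card e = 2"
    and w: "walk \<N> F Us es" and i: "i < length es" and B: "B \<in> \<N>" "es ! i \<inter> B \<noteq> {}"
  shows "B = Us ! i \<or> B = Us ! Suc i"
proof (rule ccontr)
  assume *: "\<not> ?thesis"
  have n: "Us ! i \<in> \<N>" "Us ! Suc i \<in> \<N>" using walk_node_in[OF w] i by auto
  note e = walk_edge_ends[OF w i]
  have "Us ! i \<inter> Us ! Suc i = {}" "B \<inter> Us ! i = {}" "B \<inter> Us ! Suc i = {}"
    using \<N> n B e(1) * unfolding pairwise_def disjnt_def by blast+
  then show False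
    using edge_meets_disjoint(2)[of "es ! i" "Us ! i" "Us ! Suc i"] F walk_edge_in[OF w i] e B by blast
qed

lemma alternating_parity:
  assumes "alternating M es" "es ! 0 \<notin> M" "i < length es"
  shows "es ! i \<in> M \<longleftrightarrow> odd i"
  using assms(3)
proof (induction i)
  case 0
  then show ?case using assms(2) by simp
next
  case (Suc i)
  then show ?case using assms(1) unfolding alternating_def by auto
qed

lemma alternatingI: "(\<And>i. i < length es \<Longrightarrow> es ! i \<in> M \<longleftrightarrow> odd i) \<Longrightarrow> alternating M es"
  by (simp add: alternating_def)

text \<open>The first edge meets the uncovered start node, so it is not in \<open>M\<close>;
  alternation then fixes all later edges. Most later arguments about alternating walks use this
  index parity.\<close>

lemma uncovered_start_parity:
  assumes "walk \<N> F Us es" "alternating M es" "uncovered M (hd Us)" "i < length es"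
  shows "es ! i \<in> M \<longleftrightarrow> odd i"
proof (rule alternating_parity[OF assms(2) _ assms(4)])
  have "0 < length es" using assms(4) by (cases es) auto
  then have "es ! 0 \<inter> hd Us \<noteq> {}" using walk_edge_ends(2)[OF assms(1)] walk_hd[OF assms(1)] by simp
  then show "es ! 0 \<notin> M" using assms(3) by (auto simp: uncovered_def)
qed

text \<open>Serves two purposes: augmenting along an odd path between exposed nodes, and moving the
  missed node of a blossom along an even path in its cycle. The end node has to be uncovered in the
  odd case only; a nonempty even path ends with an edge of \<open>M\<close>. By the second
  conclusion an odd path leaves none of its nodes uncovered, and an even one at most its
  last.\<close>

lemma switch_along_path:
  assumes \<N>: "pairwise disjnt \<N>" and F: "\<forall>e\<in>F. card e = 2"
    and w: "walk \<N> F Us es" and alt: "alternating M es" and dist: "distinct Us"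
    and M: "node_matching \<N> M" and hd: "uncovered M (hd Us)"
    and last: "odd (length es) \<Longrightarrow> uncovered M (last Us)"
  shows "node_matching \<N> (sym_diff M (set es))"
    and "\<And>B. B \<in> \<N> \<Longrightarrow> uncovered (sym_diff M (set es)) B \<Longrightarrow>
          B \<notin> set Us \<and> uncovered M B \<or> even (length es) \<and> B = last Us"
proof -
  let ?M = "sym_diff M (set es)"
  note len = walk_length[OF w]
  have par: "es ! i \<in> M \<longleftrightarrow> odd i" if "i < length es" for i
    using uncovered_start_parity[OF w alt hd that] .
  have hits: "B = Us ! i \<or> B = Us ! Suc i" if "i < length es" "B \<in> \<N>" "es ! i \<inter> B \<noteq> {}" for i B
    using walk_edge_hits[OF \<N> F w that] .
  have out: "e \<notin> set es" if "B \<in> \<N>" "B \<notin> set Us" "e \<inter> B \<noteq> {}" for e B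
    using that hits len by (metis Suc_less_eq in_set_conv_nth less_SucI nth_mem)
  \<comment> \<open>Edges of even index are the ones that enter the matching, and the
    \<open>k\<close>-th node is incident to the path edges \<open>k - 1\<close> and
    \<open>k\<close>. If \<open>k = length es\<close> is even, the index is out of range, but then
    every case below is contradictory: no edge of the switched matching meets the end node.\<close>
  have only: "e = es ! (if even k then k else k - 1)"
    if k: "k < length Us" and e: "e \<in> ?M" "e \<inter> Us ! k \<noteq> {}" for e k
  proof -
    have kn: "Us ! k \<in> \<N>" using walk_node_in[OF w, of k] k len by auto
    show ?thesis
    proof (cases "e \<in> M")
      case False
      then obtain i where i: "i < length es" "e = es ! i" using e by (auto simp: in_set_conv_nth)
      then have "even i" using False par by auto
      moreover have "Us ! k = Us ! i \<or> Us ! k = Us ! Suc i" using hits[OF i(1) kn] e i by auto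
      then have "k = i \<or> k = Suc i" using dist k i len by (auto simp: nth_eq_iff_index_eq)
      ultimately show ?thesis using i by auto
    next
      case True
      then have ne: "e \<notin> set es" using e by auto
      have "False"
      proof (cases "odd k")
        case odd: True
        show False
        proof (cases "k < length es")
          case True
          have "e = es ! k"
            using node_matching_unique[OF M kn] \<open>e \<in> M\<close> par[OF True] odd e(2) walk_edge_ends(2)[OF w True] by blast
          then show False using ne True by auto
        next
          case False
          then have "k = length es" using k len by auto
          then show False using last odd walk_last[OF w] e(2) \<open>e \<in> M\<close> by (auto simp: uncovered_def)
        qed
      next
        case even: False
        show False
        proof (cases k)
          case 0
          then show False using hd walk_hd[OF w] e(2) \<open>e \<in> M\<close> by (auto simp: uncovered_def)
        next
          case (Suc j)
          then have j: "j < length es" "odd j" using k len even by auto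
          have "e = es ! j"
            using node_matching_unique[OF M kn] \<open>e \<in> M\<close> par[OF j(1)] j(2) e(2) walk_edge_ends(3)[OF w j(1)] Suc by blast
          then show False using ne j by auto
        qed
      qed
      then show ?thesis ..
    qed
  qed
  show "node_matching \<N> ?M"
    unfolding node_matching_def
  proof (intro ballI conjI impI)
    fix B e assume B: "B \<in> \<N>" and e: "e \<in> ?M"
    show "\<not> e \<subseteq> B"
    proof (cases "e \<in> M")
      case True
      then show ?thesis using node_matching_not_inside[OF M B] by blast
    next
      case False
      then obtain i where i: "i < length es" "e = es ! i" using e by (auto simp: in_set_conv_nth)
      have n: "Us ! i \<in> \<N>" "Us ! Suc i \<in> \<N>" using walk_node_in[OF w] i by auto
      show ?thesis
      proof
        assume "e \<subseteq> B"
        then have "Us ! i \<inter> B \<noteq> {}" "Us ! Suc i \<inter> B \<noteq> {}" using walk_edge_ends[OF w i(1)] i(2) by blast+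
        then have "Us ! i = B" "Us ! Suc i = B" using n B \<N> unfolding pairwise_def disjnt_def by blast+
        then show False using walk_edge_ends(1)[OF w i(1)] by simp
      qed
    qed
  next
    fix B e f assume B: "B \<in> \<N>" and e: "e \<in> ?M" and f: "f \<in> ?M" and h: "e \<inter> B \<noteq> {}" "f \<inter> B \<noteq> {}"
    show "e = f"
    proof (cases "B \<in> set Us")
      case True
      then obtain k where "k < length Us" "B = Us ! k" by (auto simp: in_set_conv_nth)
      then show ?thesis using only[of k e] only[of k f] e f h by simp
    next
      case False
      then have "e \<in> M" "f \<in> M" using out[OF B False] e f h by auto
      then show ?thesis using node_matching_unique[OF M B] h by blast
    qed
  qed
  fix B assume B: "B \<in> \<N>" and unc: "uncovered ?M B"
  show "B \<notin> set Us \<and> uncovered M B \<or> even (length es) \<and> B = last Us"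
  proof (cases "B \<in> set Us")
    case False
    have "uncovered M B"
      unfolding uncovered_def
    proof (intro ballI, rule ccontr)
      fix e assume "e \<in> M" "e \<inter> B \<noteq> {}"
      then show False using out[OF B False, of e] unc unfolding uncovered_def by (metis Diff_iff Un_iff)
    qed
    then show ?thesis using False by simp
  next
    case True
    then obtain k where k: "k < length Us" "B = Us ! k" by (auto simp: in_set_conv_nth)
    \<comment> \<open>An edge of even index is outside \<open>M\<close>, hence in the switched
      matching, and would cover \<open>B\<close>. Every position on the path has such an edge,
      except an end at even distance from the start.\<close>
    have no: "\<not> (even i \<and> es ! i \<inter> B \<noteq> {})" if "i < length es" for i
    proof
      assume "even i \<and> es ! i \<inter> B \<noteq> {}"
      then show False using unc par[OF that] nth_mem[OF that] unfolding uncovered_def by (metis Diff_iff Un_iff)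
    qed
    show ?thesis
    proof (cases "even k")
      case True
      show ?thesis
      proof (cases "k < length es")
        case True
        then show ?thesis using no[of k] \<open>even k\<close> k walk_edge_ends(2)[OF w True] by auto
      next
        case False
        then have "k = length es" using k len by auto
        then show ?thesis using walk_last[OF w] k \<open>even k\<close> by auto
      qed
    next
      case False
      then obtain j where j: "k = Suc j" by (cases k) auto
      then show ?thesis using no[of j] False k len walk_edge_ends(3)[OF w, of j] by auto
    qed
  qed
qed

section \<open>Weak duality for matchings of fixed cardinality\<close>

definition vertex_potential :: "'v set \<Rightarrow> ('v set \<Rightarrow> real) \<Rightarrow> 'v \<Rightarrow> real" where
  "vertex_potential V y v = (\<Sum>U | U \<in> odd_sets V \<and> v \<in> U. y U)"

definition edges_inside :: "'v set set \<Rightarrow> 'v set \<Rightarrow> 'v set set" where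
  "edges_inside N U = {e\<in>N. e \<subseteq> U}"

lemma finite_odd_sets: "finite V \<Longrightarrow> finite (odd_sets V)"
  unfolding odd_sets_def by (rule finite_subset[of _ "Pow V"]) auto

lemma finite_edges: "simple_graph V E \<Longrightarrow> finite E"
  unfolding simple_graph_def by (rule finite_subset[of _ "Pow V"]) auto

lemma finite_matching: "simple_graph V E \<Longrightarrow> matching E N \<Longrightarrow> finite N"
  using finite_edges finite_subset unfolding matching_def by metis

lemma matching_edge:
  assumes "simple_graph V E" "matching E N" "e \<in> N"
  shows "e \<in> E" "e \<subseteq> V" "card e = 2" "finite e"
proof -
  show "e \<in> E" using assms by (auto simp: matching_def)
  then show "e \<subseteq> V" "card e = 2" using assms by (auto simp: simple_graph_def)
  then show "finite e" using card.infinite by fastforce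
qed

lemma matching_disjoint: "matching E N \<Longrightarrow> e \<in> N \<Longrightarrow> f \<in> N \<Longrightarrow> e \<noteq> f \<Longrightarrow> e \<inter> f = {}"
  unfolding matching_def pairwise_def disjnt_def by blast

lemma matching_edges_inside: "matching E N \<Longrightarrow> matching E (edges_inside N U)"
  unfolding matching_def edges_inside_def pairwise_def by blast

lemma card_matching_vertices:
  assumes "simple_graph V E" "matching E N"
  shows "card (\<Union> N) = 2 * card N"
proof -
  have "card (\<Union> N) = (\<Sum>e\<in>N. card e)"
    using assms(2) matching_edge(4)[OF assms] by (intro card_Union_disjoint) (auto simp: matching_def)
  also have "\<dots> = (\<Sum>e\<in>N. 2)" by (rule sum.cong) (use matching_edge[OF assms] in auto)
  finally show ?thesis by simp
qed

text \<open>Disjoint edges inside \<open>U\<close> cover an even number of its vertices, while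
  \<open>U\<close> has odd size.\<close>

lemma edges_inside_bound:
  assumes "simple_graph V E" "matching E N" "U \<in> odd_sets V"
  shows "2 * card (edges_inside N U) \<le> card U - 1"
proof -
  have U: "finite U" "odd (card U)"
    using assms(1,3) finite_subset by (auto simp: simple_graph_def odd_sets_def)
  have "2 * card (edges_inside N U) = card (\<Union> (edges_inside N U))"
    using card_matching_vertices[OF assms(1) matching_edges_inside[OF assms(2)]] by simp
  moreover have "card (\<Union> (edges_inside N U)) \<le> card U"
    by (rule card_mono) (auto simp: U edges_inside_def)
  ultimately show ?thesis using U(2) by presburger
qed

text \<open>Double counting: a set containing exactly one end of \<open>e\<close> contributes once
  to the left side and is cut by \<open>e\<close>; a set containing both ends contributes
  twice.\<close>

lemma potential_of_edge:
  assumes "simple_graph V E" "e \<in> E"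
  shows "(\<Sum>v\<in>e. vertex_potential V y v) =
         dual_load V E y e + 2 * (\<Sum>U\<in>odd_sets V. if e \<subseteq> U then y U else 0)"
proof -
  have fin: "finite (odd_sets V)" using assms finite_odd_sets by (auto simp: simple_graph_def)
  have "card e = 2" using assms by (auto simp: simple_graph_def)
  then obtain a b where e: "e = {a, b}" "a \<noteq> b" by (auto simp: card_2_iff)
  have vp: "vertex_potential V y v = (\<Sum>U\<in>odd_sets V. if v \<in> U then y U else 0)" for v
    unfolding vertex_potential_def using fin by (simp add: sum.inter_filter)
  have dl: "dual_load V E y e = (\<Sum>U\<in>odd_sets V. if card (e \<inter> U) = 1 then y U else 0)"
    unfolding dual_load_def cut_def using fin assms(2) by (simp add: sum.inter_filter)
  have "(if a \<in> U then y U else 0) + (if b \<in> U then y U else 0) =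
        (if card (e \<inter> U) = 1 then y U else 0) + 2 * (if e \<subseteq> U then y U else 0)" for U
    using e by (cases "a \<in> U"; cases "b \<in> U") auto
  then have "(\<Sum>U\<in>odd_sets V. (if a \<in> U then y U else 0) + (if b \<in> U then y U else 0)) =
        (\<Sum>U\<in>odd_sets V. (if card (e \<inter> U) = 1 then y U else 0) + 2 * (if e \<subseteq> U then y U else 0))"
    by simp
  then show ?thesis
    unfolding dl using e by (simp add: vp sum.distrib sum_distrib_left)
qed

lemma sum_dual_load:
  assumes "simple_graph V E" "matching E N"
  shows "(\<Sum>e\<in>N. dual_load V E y e) =
         (\<Sum>v\<in>\<Union> N. vertex_potential V y v) - 2 * (\<Sum>U\<in>odd_sets V. y U * card (edges_inside N U))"
proof -
  note fin = finite_matching[OF assms]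
  have "(\<Sum>v\<in>\<Union> N. vertex_potential V y v) = (\<Sum>e\<in>N. \<Sum>v\<in>e. vertex_potential V y v)"
    using sum.Union_disjoint[of N "vertex_potential V y"] matching_edge[OF assms] matching_disjoint[OF assms(2)]
    by simp
  also have "\<dots> = (\<Sum>e\<in>N. dual_load V E y e + 2 * (\<Sum>U\<in>odd_sets V. if e \<subseteq> U then y U else 0))"
    using potential_of_edge[OF assms(1)] matching_edge(1)[OF assms] by (intro sum.cong) auto
  also have "\<dots> = (\<Sum>e\<in>N. dual_load V E y e) + 2 * (\<Sum>e\<in>N. \<Sum>U\<in>odd_sets V. if e \<subseteq> U then y U else 0)"
    by (simp add: sum.distrib sum_distrib_left)
  also have "(\<Sum>e\<in>N. \<Sum>U\<in>odd_sets V. if e \<subseteq> U then y U else 0) =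
             (\<Sum>U\<in>odd_sets V. \<Sum>e\<in>N. if e \<subseteq> U then y U else 0)"
    by (rule sum.swap)
  also have "\<dots> = (\<Sum>U\<in>odd_sets V. y U * card (edges_inside N U))"
    using fin by (intro sum.cong) (auto simp: edges_inside_def sum.inter_filter[symmetric] mult.commute)
  finally show ?thesis by simp
qed

text \<open>Compare the deficits \<open>c - y v\<close>. They are nonnegative and vanish on
  \<open>B - A\<close>, so the total deficit of \<open>B\<close> is part of that of
  \<open>A\<close>; equal cardinality cancels the multiples of \<open>c\<close>. In the application
  \<open>A\<close> is covered by the algorithm's matching and \<open>B\<close> by a
  competitor.\<close>

lemma sum_le_sum_same_card:
  fixes y :: "'a \<Rightarrow> real"
  assumes "finite A" "finite B" "card A = card B"
    and le: "\<And>v. v \<in> A \<union> B \<Longrightarrow> y v \<le> c" and eq: "\<And>v. v \<in> B - A \<Longrightarrow> y v = c"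
  shows "sum y A \<le> sum y B"
proof -
  have "(\<Sum>v\<in>B. c - y v) = (\<Sum>v\<in>B \<inter> A. c - y v)"
    using assms by (intro sum.mono_neutral_right) auto
  also have "\<dots> \<le> (\<Sum>v\<in>A. c - y v)" using assms by (intro sum_mono2) auto
  finally show ?thesis using assms(3) by (simp add: sum_subtractf)
qed

lemma complementary_slackness_optimal:
  assumes G: "simple_graph V E" and M: "matching E M" and feas: "dual_feasible V E w y"
    and tight: "\<And>e. e \<in> M \<Longrightarrow> dual_load V E y e = w e"
    and near_perfect: "\<And>U. U \<in> odd_sets V \<Longrightarrow> y U \<noteq> 0 \<Longrightarrow> 3 \<le> card U \<Longrightarrow>
                         card U - 1 \<le> 2 * card (edges_inside M U)"
    and le: "\<And>v. v \<in> V \<Longrightarrow> vertex_potential V y v \<le> c"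
    and eq: "\<And>v. v \<in> V \<Longrightarrow> v \<notin> \<Union> M \<Longrightarrow> vertex_potential V y v = c"
  shows "cardinality_optimal E w M"
  unfolding cardinality_optimal_def
proof (intro conjI allI impI)
  fix N assume "matching E N \<and> card N = card M"
  then have N: "matching E N" "card N = card M" by auto
  have "(\<Sum>v\<in>\<Union> M. vertex_potential V y v) \<le> (\<Sum>v\<in>\<Union> N. vertex_potential V y v)"
  proof (rule sum_le_sum_same_card[where c = c])
    show "card (\<Union> M) = card (\<Union> N)" using card_matching_vertices[OF G] M N by simp
    have sub: "\<Union> M \<subseteq> V" "\<Union> N \<subseteq> V" using matching_edge(2)[OF G] M N by blast+
    then show "finite (\<Union> M)" "finite (\<Union> N)" using G finite_subset unfolding simple_graph_def by metis+
    show "vertex_potential V y v \<le> c" if "v \<in> \<Union> M \<union> \<Union> N" for v using that sub le by blast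
    show "vertex_potential V y v = c" if "v \<in> \<Union> N - \<Union> M" for v using that sub eq by blast
  qed
  moreover have "(\<Sum>U\<in>odd_sets V. y U * card (edges_inside N U)) \<le> (\<Sum>U\<in>odd_sets V. y U * card (edges_inside M U))"
  proof (rule sum_mono)
    fix U assume U: "U \<in> odd_sets V"
    show "y U * card (edges_inside N U) \<le> y U * card (edges_inside M U)"
    proof (cases "3 \<le> card U \<and> y U \<noteq> 0")
      case True
      have "card (edges_inside N U) \<le> card (edges_inside M U)"
        using edges_inside_bound[OF G N(1) U] near_perfect[OF U] True by linarith
      moreover have "0 \<le> y U" using feas U True by (auto simp: dual_feasible_def)
      ultimately show ?thesis by (intro mult_left_mono) auto
    next
      case False
      \<comment> \<open>Here \<open>y U\<close> may be negative, but then \<open>U\<close> is a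
        singleton and contains no edge, so both products are 0.\<close>
      have "odd (card U)" using U by (auto simp: odd_sets_def)
      then have "3 \<le> card U \<or> card U = 1" by presburger
      then have "card U = 1 \<or> y U = 0" using False by blast
      then show ?thesis using edges_inside_bound[OF G N(1) U] edges_inside_bound[OF G M U] by auto
    qed
  qed
  ultimately have "(\<Sum>e\<in>M. dual_load V E y e) \<le> (\<Sum>e\<in>N. dual_load V E y e)"
    using sum_dual_load[OF G M, of y] sum_dual_load[OF G N(1), of y] by linarith
  also have "\<dots> \<le> sum w N" using feas matching_edge(1)[OF G N(1)] by (intro sum_mono) (auto simp: dual_feasible_def)
  finally show "sum w M \<le> sum w N" using tight by simp
qed (rule M)

section \<open>The invariant of the algorithm\<close>

text \<open>\<open>leaving_edge_base\<close> links the nesting levels: the blossom is entered from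
  outside only at a cycle node that \<open>near\<close> misses, and \<open>near_misses_one\<close>
  makes this node unique. \<open>cycle_tight\<close> speaks of the whole cycle rather than of
  \<open>near\<close>, because a later augmentation may switch to any of its edges.\<close>

locale blossom_state =
  fixes V :: "'v set" and E :: "'v set set" and w :: "'v set \<Rightarrow> real" and s :: "'v state"
  assumes graph: "simple_graph V E"
    and family_odd: "family s \<subseteq> odd_sets V"
    and singleton_in_family: "v \<in> V \<Longrightarrow> {v} \<in> family s"
    and family_laminar: "laminar (family s)"
    and dual_support: "U \<notin> family s \<Longrightarrow> dual s U = 0"
    and feasible: "dual_feasible V E w (dual s)"
    and cmatch_tight: "cmatch s \<subseteq> tight_edges V E w s"
    and cmatch_node_matching: "node_matching (nodes s) (cmatch s)"
    and cycle_tight: "U \<in> blossoms s \<Longrightarrow> cycle s U \<subseteq> tight_edges V E w s"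
    and cycle_inside: "U \<in> blossoms s \<Longrightarrow> e \<in> cycle s U \<Longrightarrow> e \<subseteq> U"
    and near_subset_cycle: "U \<in> blossoms s \<Longrightarrow> near s U \<subseteq> cycle s U"
    and near_node_matching: "U \<in> blossoms s \<Longrightarrow> node_matching (cycle_nodes s U) (near s U)"
    and near_misses_one: "U \<in> blossoms s \<Longrightarrow> W \<in> cycle_nodes s U \<Longrightarrow> W' \<in> cycle_nodes s U \<Longrightarrow>
          uncovered (near s U) W \<Longrightarrow> uncovered (near s U) W' \<Longrightarrow> W = W'"
    and leaving_edge_base: "U \<in> blossoms s \<Longrightarrow> e \<in> full_matching s \<Longrightarrow> e \<in> cut E U \<Longrightarrow>
          W \<in> cycle_nodes s U \<Longrightarrow> e \<inter> W \<noteq> {} \<Longrightarrow> uncovered (near s U) W"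
begin

section \<open>Maximal sets and cycle nodes as partitions\<close>

lemma finite_V: "finite V"
  using graph by (simp add: simple_graph_def)

lemma finite_family: "finite (family s)"
  using family_odd finite_odd_sets[OF finite_V] finite_subset by blast

lemma family_member:
  assumes "U \<in> family s" shows "U \<subseteq> V" "odd (card U)" "finite U" "U \<noteq> {}"
proof -
  show "U \<subseteq> V" "odd (card U)" using assms family_odd by (auto simp: odd_sets_def)
  then show "finite U" "U \<noteq> {}" using finite_V finite_subset by auto
qed

lemma family_nested: "A \<in> family s \<Longrightarrow> B \<in> family s \<Longrightarrow> A \<inter> B \<noteq> {} \<Longrightarrow> A \<subseteq> B \<or> B \<subseteq> A"
  using family_laminar unfolding laminar_def by blast

lemma nodes_in_family: "B \<in> nodes s \<Longrightarrow> B \<in> family s"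
  by (simp add: nodes_def maximal_sets_def)

lemma nodes_disjoint: "pairwise disjnt (nodes s)"
  unfolding nodes_def by (rule maximal_sets_disjoint[OF family_laminar])

lemma nodes_eq: "A \<in> nodes s \<Longrightarrow> B \<in> nodes s \<Longrightarrow> A \<inter> B \<noteq> {} \<Longrightarrow> A = B"
  using nodes_disjoint unfolding pairwise_def disjnt_def by blast

lemma node_above:
  assumes "U \<in> family s" obtains B where "B \<in> nodes s" "U \<subseteq> B"
  using maximal_superset[OF finite_family assms] unfolding nodes_def .

lemma node_containing:
  assumes "v \<in> V" obtains B where "B \<in> nodes s" "v \<in> B"
  using node_above[OF singleton_in_family[OF assms]] by blast

lemma node_contains_member:
  assumes "B \<in> nodes s" "U \<in> family s" "U \<inter> B \<noteq> {}" shows "U \<subseteq> B"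
proof -
  obtain B' where B': "B' \<in> nodes s" "U \<subseteq> B'" using node_above[OF assms(2)] .
  then have "B' = B" using nodes_eq[OF B'(1) assms(1)] assms(3) by blast
  then show ?thesis using B' by simp
qed

lemma cycle_nodes_in_family:
  assumes "W \<in> cycle_nodes s U" shows "W \<in> family s" "W \<subset> U"
  using assms by (simp_all add: cycle_nodes_def maximal_sets_def)

lemma cycle_nodes_disjoint: "pairwise disjnt (cycle_nodes s U)"
  unfolding cycle_nodes_def
  by (rule maximal_sets_disjoint) (use family_laminar in \<open>auto simp: laminar_def\<close>)

lemma cycle_node_above:
  assumes "W \<in> family s" "W \<subset> U" obtains W' where "W' \<in> cycle_nodes s U" "W \<subseteq> W'"
  using maximal_superset[of "{W \<in> family s. W \<subset> U}" W] finite_family assms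
  unfolding cycle_nodes_def by auto

lemma blossom_in_family: "U \<in> blossoms s \<Longrightarrow> U \<in> family s"
  by (simp add: blossoms_def)

lemma cycle_node_containing:
  assumes "U \<in> blossoms s" "v \<in> U" obtains W where "W \<in> cycle_nodes s U" "v \<in> W"
proof -
  have "v \<in> V" using family_member[OF blossom_in_family] assms by blast
  moreover have "{v} \<noteq> U" using assms(1) by (auto simp: blossoms_def)
  ultimately show thesis using cycle_node_above[OF singleton_in_family, of v U] assms that by blast
qed

lemma tight_edge:
  assumes "e \<in> tight_edges V E w s"
  shows "e \<in> E" "e \<subseteq> V" "card e = 2" "dual_load V E (dual s) e = w e"
  using assms graph by (auto simp: tight_edges_def simple_graph_def)

lemma tight_edges_card: "\<forall>e\<in>tight_edges V E w s. card e = 2"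
  using tight_edge by blast

section \<open>The recorded pieces form a matching, near-perfect inside each member\<close>

lemma near_inside: "U \<in> blossoms s \<Longrightarrow> e \<in> near s U \<Longrightarrow> e \<subseteq> U"
  using near_subset_cycle cycle_inside by blast

lemma full_matching_cases:
  assumes "e \<in> full_matching s"
  obtains "e \<in> cmatch s" | U where "U \<in> blossoms s" "e \<in> near s U"
  using assms by (auto simp: full_matching_def)

lemma full_matching_tight: "full_matching s \<subseteq> tight_edges V E w s"
  using cmatch_tight near_subset_cycle cycle_tight by (fastforce simp: full_matching_def)

lemma near_in_full_matching: "U \<in> blossoms s \<Longrightarrow> near s U \<subseteq> full_matching s"
  by (auto simp: full_matching_def)

text \<open>By \<open>leaving_edge_base\<close>, the cycle node containing the inner end
  \<open>v\<close> of the crossing edge is missed by \<open>near s U\<close>.\<close>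

lemma crossing_edge_not_near:
  assumes U: "U \<in> blossoms s" and e: "e \<in> full_matching s" "\<not> e \<subseteq> U"
    and v: "v \<in> e" "v \<in> U" and f: "f \<in> near s U"
  shows "v \<notin> f"
proof
  assume vf: "v \<in> f"
  have "e \<in> tight_edges V E w s" using e full_matching_tight by blast
  then have "e \<in> cut E U" using edge_crosses[of e U] tight_edge e(2) v by (auto simp: cut_def)
  moreover obtain W where W: "W \<in> cycle_nodes s U" "v \<in> W" using cycle_node_containing[OF U v(2)] .
  ultimately have "uncovered (near s U) W" using leaving_edge_base[OF U e(1) _ W(1)] W v by blast
  then show False using f vf W by (auto simp: uncovered_def)
qed

lemma cmatch_not_inside:
  assumes "e \<in> cmatch s" "U \<in> family s" shows "\<not> e \<subseteq> U"
proof -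
  obtain B where "B \<in> nodes s" "U \<subseteq> B" using node_above[OF assms(2)] .
  then show ?thesis using node_matching_not_inside[OF cmatch_node_matching _ assms(1)] by blast
qed

lemma near_not_inside:
  assumes "U \<in> blossoms s" "e \<in> near s U" "W \<in> family s" "W \<subset> U" shows "\<not> e \<subseteq> W"
proof -
  obtain W' where "W' \<in> cycle_nodes s U" "W \<subseteq> W'" using cycle_node_above[OF assms(3,4)] .
  then show ?thesis using node_matching_not_inside[OF near_node_matching[OF assms(1)] _ assms(2)] by blast
qed

text \<open>The disjunction leaves out only edges recorded for smaller blossoms inside
  \<open>U\<close>. These are handled in \<open>near_edges_unique\<close> from the viewpoint of the
  smaller blossom, where an edge recorded for the larger one is never inside and hence
  crosses.\<close>

lemma near_edge_unique:
  assumes U: "U \<in> blossoms s" and e: "e \<in> full_matching s" "\<not> e \<subseteq> U \<or> e \<in> near s U"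
    and f: "f \<in> near s U" and v: "v \<in> e" "v \<in> f"
  shows "e = f"
proof -
  have vU: "v \<in> U" using near_inside[OF U f] v by blast
  then have near: "e \<in> near s U" using crossing_edge_not_near[OF U e(1) _ v(1) vU f] e(2) v by blast
  obtain W where "W \<in> cycle_nodes s U" "v \<in> W" using cycle_node_containing[OF U vU] .
  then show ?thesis using node_matching_unique[OF near_node_matching[OF U] _ near f] v by blast
qed

lemma near_edges_unique:
  assumes U: "U \<in> blossoms s" "e \<in> near s U" and U': "U' \<in> blossoms s" "f \<in> near s U'"
    and v: "v \<in> e" "v \<in> f" and sub: "U' \<subseteq> U"
  shows "e = f"
proof (cases "U' = U")
  case True
  then show ?thesis using near_edge_unique[OF U'(1) _ _ U'(2) v] U near_in_full_matching by blast
next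
  case False
  then have "\<not> e \<subseteq> U'" using near_not_inside[OF U blossom_in_family[OF U'(1)]] sub by blast
  then show ?thesis using near_edge_unique[OF U'(1) _ _ U'(2) v] U near_in_full_matching by blast
qed

lemma full_matching_unique_at_vertex:
  assumes e: "e \<in> full_matching s" and f: "f \<in> full_matching s" and v: "v \<in> e" "v \<in> f"
  shows "e = f"
proof -
  have cmatch_near: "e' = f'" if "e' \<in> cmatch s" "U \<in> blossoms s" "f' \<in> near s U" "v \<in> e'" "v \<in> f'" for e' f' U
    using near_edge_unique[OF that(2) _ _ that(3-5)] cmatch_not_inside[OF that(1) blossom_in_family[OF that(2)]] that(1)
    by (auto simp: full_matching_def)
  show ?thesis
    using e
  proof (cases rule: full_matching_cases)
    case 1
    show ?thesis
      using f
    proof (cases rule: full_matching_cases)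
      case 1
      have "v \<in> V" using tight_edge(2) full_matching_tight e v by blast
      then obtain B where "B \<in> nodes s" "v \<in> B" using node_containing by blast
      then show ?thesis
        using node_matching_unique[OF cmatch_node_matching _ \<open>e \<in> cmatch s\<close> 1] v by blast
    qed (use cmatch_near[OF \<open>e \<in> cmatch s\<close> _ _ v] in blast)
  next
    case U: (2 U)
    show ?thesis
      using f
    proof (cases rule: full_matching_cases)
      case 1
      then show ?thesis using cmatch_near[OF 1 U v(2) v(1)] by simp
    next
      case U': (2 U')
      have "U \<inter> U' \<noteq> {}" using near_inside[OF U] near_inside[OF U'] v by blast
      then consider "U' \<subseteq> U" | "U \<subseteq> U'"
        using family_nested[OF blossom_in_family[OF U(1)] blossom_in_family[OF U'(1)]] by blast
      then show ?thesis
      proof cases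
        case 1
        then show ?thesis using near_edges_unique[OF U U' v] by simp
      next
        case 2
        then show ?thesis using near_edges_unique[OF U' U v(2) v(1)] by simp
      qed
    qed
  qed
qed

lemma matching_full_matching: "matching E (full_matching s)"
  unfolding matching_def pairwise_def disjnt_def
  using full_matching_tight tight_edge(1) full_matching_unique_at_vertex by blast

text \<open>All vertices of \<open>U\<close> other than \<open>z\<close> are already matched inside
  \<open>U\<close>, so the end of \<open>f\<close> in \<open>U\<close> must be \<open>z\<close>;
  thus one entering edge completes the covering of \<open>U\<close>. Applied both to a cycle node
  inside its blossom and to a maximal set.\<close>

lemma member_covered_from_outside:
  assumes z: "\<And>v. v \<in> U \<Longrightarrow> v \<noteq> z \<Longrightarrow> \<exists>e\<in>full_matching s. v \<in> e \<and> e \<subseteq> U"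
    and f: "f \<in> full_matching s" "f \<inter> U \<noteq> {}" "\<not> f \<subseteq> U" and v: "v \<in> U"
  shows "\<exists>e\<in>full_matching s. v \<in> e \<and> (e \<subseteq> U \<or> e = f)"
proof -
  obtain p where p: "p \<in> f" "p \<in> U" using f by blast
  have "p = z"
  proof (rule ccontr)
    assume "p \<noteq> z"
    then obtain e where "e \<in> full_matching s" "p \<in> e" "e \<subseteq> U" using z p by blast
    then show False using full_matching_unique_at_vertex[OF _ f(1) _ p(1)] f(3) by blast
  qed
  then show ?thesis using z[OF v] f(1) p by (cases "v = z") auto
qed

text \<open>Induction on the size: a cycle node met by \<open>near s U\<close> is covered
  completely, since its one deficient vertex is the end of that edge. At most one cycle node is
  missed, and it supplies \<open>z\<close>.\<close>

lemma near_perfect_inside_member: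
  assumes "U \<in> family s"
  shows "\<exists>z\<in>U. \<forall>v\<in>U. v \<noteq> z \<longrightarrow> (\<exists>e\<in>full_matching s. v \<in> e \<and> e \<subseteq> U)"
  using assms
proof (induction "card U" arbitrary: U rule: less_induct)
  case less
  note U = family_member[OF less.prems]
  show ?case
  proof (cases "3 \<le> card U")
    case False
    then have "card U = 1" using U by presburger
    then obtain z where "U = {z}" by (auto simp: card_1_singleton_iff)
    then show ?thesis by auto
  next
    case True
    then have bl: "U \<in> blossoms s" using less.prems by (simp add: blossoms_def)
    have IH: "\<exists>z\<in>W. \<forall>v\<in>W. v \<noteq> z \<longrightarrow> (\<exists>e\<in>full_matching s. v \<in> e \<and> e \<subseteq> W)" if "W \<in> cycle_nodes s U" for W
      using less.hyps[of W] cycle_nodes_in_family[OF that] psubset_card_mono[OF U(3)] by blast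
    have cov: "\<exists>e\<in>full_matching s. v \<in> e \<and> e \<subseteq> U"
      if W: "W \<in> cycle_nodes s U" "v \<in> W" and c: "\<not> uncovered (near s U) W" for v W
    proof -
      obtain f where f: "f \<in> near s U" "f \<inter> W \<noteq> {}" using c by (auto simp: uncovered_def)
      obtain z where z: "\<And>v. v \<in> W \<Longrightarrow> v \<noteq> z \<Longrightarrow> \<exists>e\<in>full_matching s. v \<in> e \<and> e \<subseteq> W" using IH[OF W(1)] by blast
      have "\<exists>e\<in>full_matching s. v \<in> e \<and> (e \<subseteq> W \<or> e = f)"
        using member_covered_from_outside[OF z _ f(2) _ W(2)] near_in_full_matching[OF bl] f(1)
          near_not_inside[OF bl f(1) cycle_nodes_in_family[OF W(1)]] by blast
      then show ?thesis using cycle_nodes_in_family(2)[OF W(1)] near_inside[OF bl f(1)] by blast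
    qed
    show ?thesis
    proof (cases "\<exists>W\<in>cycle_nodes s U. uncovered (near s U) W")
      case False
      \<comment> \<open>All of \<open>U\<close> is covered from inside in this case, so any
        \<open>z\<close> serves.\<close>
      obtain z where "z \<in> U" using U(4) by blast
      then show ?thesis using cov False cycle_node_containing[OF bl] by metis
    next
      case True
      then obtain W0 where W0: "W0 \<in> cycle_nodes s U" "uncovered (near s U) W0" by blast
      then obtain z where z: "z \<in> W0" "\<forall>v\<in>W0. v \<noteq> z \<longrightarrow> (\<exists>e\<in>full_matching s. v \<in> e \<and> e \<subseteq> W0)"
        using IH by blast
      have W0U: "W0 \<subseteq> U" using cycle_nodes_in_family[OF W0(1)] by auto
      have "\<exists>e\<in>full_matching s. v \<in> e \<and> e \<subseteq> U" if v: "v \<in> U" "v \<noteq> z" for v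
      proof -
        obtain W where W: "W \<in> cycle_nodes s U" "v \<in> W" using cycle_node_containing[OF bl v(1)] .
        show ?thesis
        proof (cases "W = W0")
          case True
          then obtain e where "e \<in> full_matching s" "v \<in> e" "e \<subseteq> W0" using z(2) W(2) v(2) by auto
          then show ?thesis using W0U by blast
        next
          case False
          then have "\<not> uncovered (near s U) W" using near_misses_one[OF bl W(1) W0(1) _ W0(2)] by auto
          then show ?thesis using cov[OF W] by simp
        qed
      qed
      then show ?thesis using z(1) W0U by blast
    qed
  qed
qed

text \<open>If an edge of \<open>cmatch\<close> entered \<open>B\<close>, it would cover the only
  vertex of \<open>B\<close> not matched inside, leaving no room for the exposed
  \<open>v\<close>.\<close>

lemma exposed_vertex_in_exposed_node:
  assumes B: "B \<in> nodes s" and v: "v \<in> B" "v \<notin> \<Union> (full_matching s)"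
  shows "B \<in> exposed_nodes s"
proof -
  have "uncovered (cmatch s) B"
    unfolding uncovered_def
  proof (intro ballI, rule ccontr)
    fix f assume f: "f \<in> cmatch s" "f \<inter> B \<noteq> {}"
    obtain z where z: "\<And>v. v \<in> B \<Longrightarrow> v \<noteq> z \<Longrightarrow> \<exists>e\<in>full_matching s. v \<in> e \<and> e \<subseteq> B"
      using near_perfect_inside_member[OF nodes_in_family[OF B]] by blast
    have "\<exists>e\<in>full_matching s. v \<in> e \<and> (e \<subseteq> B \<or> e = f)"
      using member_covered_from_outside[OF z _ f(2) cmatch_not_inside[OF f(1) nodes_in_family[OF B]] v(1)] f(1)
      by (auto simp: full_matching_def)
    then show False using v(2) by blast
  qed
  then show ?thesis using B by (simp add: exposed_nodes_def)
qed

lemma card_inside_member: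
  assumes U: "U \<in> family s"
  shows "card U - 1 \<le> 2 * card (edges_inside (full_matching s) U)"
proof -
  let ?I = "edges_inside (full_matching s) U"
  obtain z where z: "\<forall>v\<in>U. v \<noteq> z \<longrightarrow> (\<exists>e\<in>full_matching s. v \<in> e \<and> e \<subseteq> U)" "z \<in> U"
    using near_perfect_inside_member[OF U] by blast
  then have "U - {z} \<subseteq> \<Union> ?I" by (auto simp: edges_inside_def)
  moreover have "finite (\<Union> ?I)" by (rule finite_subset[OF _ family_member(3)[OF U]]) (auto simp: edges_inside_def)
  ultimately have "card (U - {z}) \<le> card (\<Union> ?I)" by (rule card_mono[rotated])
  then show ?thesis
    using z(2) card_matching_vertices[OF graph matching_edges_inside[OF matching_full_matching]] by simp
qed

lemma optimal_if_exposed_potential_maximal: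
  assumes "\<And>v. v \<in> V \<Longrightarrow> vertex_potential V (dual s) v \<le> c"
    and "\<And>v. v \<in> V \<Longrightarrow> v \<notin> \<Union> (full_matching s) \<Longrightarrow> vertex_potential V (dual s) v = c"
  shows "cardinality_optimal E w (full_matching s)"
  by (rule complementary_slackness_optimal[OF graph matching_full_matching feasible _ _ assms])
    (use full_matching_tight tight_edge(4) card_inside_member dual_support in blast)+

end

text \<open>The bound \<open>c\<close> is a parameter because it moves along the run: it starts as
  \<open>\<beta>\<close>, and each dual update adds that update's \<open>\<delta>\<close>.\<close>

definition exposed_potential_maximal :: "'v set \<Rightarrow> 'v state \<Rightarrow> real \<Rightarrow> bool" where
  "exposed_potential_maximal V s c \<longleftrightarrow>
     (\<forall>v\<in>V. vertex_potential V (dual s) v \<le> c \<and>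
             (v \<notin> \<Union> (full_matching s) \<longrightarrow> vertex_potential V (dual s) v = c))"

section \<open>Initial state and augmentation\<close>

lemma blossom_state_init:
  assumes G: "simple_graph V E" and init: "edmonds_init V E w s"
  shows "blossom_state V E w s"
proof -
  have fam: "family s = (\<lambda>v. {v}) ` V" and M: "cmatch s = {}" using init by (auto simp: edmonds_init_def)
  have bl: "blossoms s = {}" by (auto simp: blossoms_def fam)
  show ?thesis
  proof
    show "family s \<subseteq> odd_sets V" by (auto simp: fam odd_sets_def)
    show "laminar (family s)" by (auto simp: fam laminar_def)
  qed (use G init in \<open>auto simp: edmonds_init_def bl node_matching_def\<close>)
qed

lemma exposed_potential_maximal_init:
  assumes G: "simple_graph V E" and init: "edmonds_init V E w s" and \<beta>: "\<forall>v\<in>V. dual s {v} = \<beta>"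
  shows "exposed_potential_maximal V s \<beta>"
proof -
  have "vertex_potential V (dual s) v = \<beta>" if v: "v \<in> V" for v
  proof -
    have fin: "finite (odd_sets V)" using G finite_odd_sets by (auto simp: simple_graph_def)
    have "vertex_potential V (dual s) v = (\<Sum>U\<in>{{v}}. dual s U)"
      unfolding vertex_potential_def
    proof (rule sum.mono_neutral_right)
      show "finite {U \<in> odd_sets V. v \<in> U}" using fin by simp
      show "{{v}} \<subseteq> {U \<in> odd_sets V. v \<in> U}" using v by (auto simp: odd_sets_def)
      show "\<forall>U\<in>{U \<in> odd_sets V. v \<in> U} - {{v}}. dual s U = 0"
      proof
        fix U assume U: "U \<in> {U \<in> odd_sets V. v \<in> U} - {{v}}"
        then have "U \<notin> (\<lambda>v. {v}) ` V" by auto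
        then show "dual s U = 0" using init by (auto simp: edmonds_init_def)
      qed
    qed
    then show ?thesis using \<beta> v by simp
  qed
  then show ?thesis by (simp add: exposed_potential_maximal_def)
qed

context blossom_state
begin

lemma exposed_uncovered: "B \<in> exposed_nodes s \<Longrightarrow> uncovered (cmatch s) B"
  by (simp add: exposed_nodes_def)

lemma exposed_start_parity:
  assumes "alt_walk V E w s Us es" "hd Us \<in> exposed_nodes s" "i < length es"
  shows "es ! i \<in> cmatch s \<longleftrightarrow> odd i"
  using assms uncovered_start_parity[OF _ _ exposed_uncovered] unfolding alt_walk_def by blast

text \<open>A nonempty walk of even length from an exposed node ends with an edge of
  \<open>cmatch\<close>, which would cover the exposed end.\<close>

lemma exposed_walk_odd:
  assumes "exposed_walk V E w s Us es" shows "odd (length es)"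
proof (rule ccontr)
  assume "\<not> odd (length es)"
  have a: "alt_walk V E w s Us es" "es \<noteq> []" "hd Us \<in> exposed_nodes s" "last Us \<in> exposed_nodes s"
    using assms by (auto simp: exposed_walk_def)
  then obtain k where k: "length es = Suc k" by (cases es) auto
  then have "es ! k \<in> cmatch s" using exposed_start_parity[OF a(1,3), of k] \<open>\<not> odd (length es)\<close> by auto
  moreover have wk: "walk (nodes s) (tight_edges V E w s) Us es" using a by (simp add: alt_walk_def)
  then have "es ! k \<inter> last Us \<noteq> {}" using walk_edge_ends(3)[OF wk, of k] walk_last[OF wk] k by simp
  ultimately show False using exposed_uncovered[OF a(4)] by (auto simp: uncovered_def)
qed

text \<open>\<open>switch_along_path\<close> is applied twice: to the odd augmenting path, and to
  the even path in the cycle of each affected blossom. The link \<open>leaving_edge_base\<close> for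
  the new state is the last condition of \<open>augment_step\<close>.\<close>

lemma augment_preserves:
  assumes "augment_step V E w s s'"
  shows "blossom_state V E w s'" "dual s' = dual s"
    "V - \<Union> (full_matching s') \<subseteq> V - \<Union> (full_matching s)"
proof -
  obtain Us es N where sw: "shortest_exposed_walk V E w s Us es" and dist: "distinct Us"
    and s': "s' = s\<lparr>cmatch := sym_diff (cmatch s) (set es), near := N\<rparr>"
    and N1: "\<forall>U. U \<in> blossoms s \<and> (\<exists>B\<in>set Us. U \<subseteq> B) \<longrightarrow>
             (\<exists>Q. even_cycle_path s U Q \<and> N U = sym_diff (near s U) Q)"
    and N2: "\<forall>U. \<not> (U \<in> blossoms s \<and> (\<exists>B\<in>set Us. U \<subseteq> B)) \<longrightarrow> N U = near s U"
    and base0: "\<forall>U\<in>blossoms s. \<forall>e \<in> full_matching s' \<inter> cut E U. \<forall>W\<in>cycle_nodes s U.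
             e \<inter> W \<noteq> {} \<longrightarrow> uncovered (N U) W"
    using assms unfolding augment_step_def by (elim exE conjE) (rule that)
  have ew: "exposed_walk V E w s Us es" using sw by (simp add: shortest_exposed_walk_def)
  have base: "uncovered (N U) W" if "U \<in> blossoms s" "e \<in> full_matching s'" "e \<in> cut E U" "W \<in> cycle_nodes s U"
    "e \<inter> W \<noteq> {}" for U e W using base0 that by simp
  have wk: "walk (nodes s) (tight_edges V E w s) Us es" and alt: "alternating (cmatch s) es"
    and hd: "uncovered (cmatch s) (hd Us)" and last: "uncovered (cmatch s) (last Us)"
    using ew exposed_uncovered by (auto simp: exposed_walk_def alt_walk_def)
  note sw = switch_along_path[OF nodes_disjoint tight_edges_card wk alt dist cmatch_node_matching hd last]
  have same: "blossoms s' = blossoms s" "nodes s' = nodes s" "cycle_nodes s' = cycle_nodes s"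
    "tight_edges V E w s' = tight_edges V E w s" "family s' = family s" "dual s' = dual s" "cycle s' = cycle s"
    "near s' = N" "cmatch s' = sym_diff (cmatch s) (set es)"
    by (auto simp: s' blossoms_def nodes_def cycle_nodes_def tight_edges_def fun_eq_iff)
  have near': "N U \<subseteq> cycle s U \<and> node_matching (cycle_nodes s U) (N U) \<and>
      (\<forall>W\<in>cycle_nodes s U. \<forall>W'\<in>cycle_nodes s U. uncovered (N U) W \<longrightarrow> uncovered (N U) W' \<longrightarrow> W = W')"
    if U: "U \<in> blossoms s" for U
  proof (cases "\<exists>B\<in>set Us. U \<subseteq> B")
    case False
    then have "N U = near s U" using N2 by blast
    then show ?thesis using near_subset_cycle[OF U] near_node_matching[OF U] near_misses_one[OF U] by metis
  next
    case True
    then obtain Q where Q: "even_cycle_path s U Q" and NU: "N U = sym_diff (near s U) Q" using N1 U by blast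
    from Q obtain Us' es' where w': "walk (cycle_nodes s U) (cycle s U) Us' es'" "alternating (near s U) es'"
      "distinct Us'" "even (length es')" "uncovered (near s U) (hd Us')" "Q = set es'"
      unfolding even_cycle_path_def by blast
    have card2: "\<forall>e\<in>cycle s U. card e = 2" using cycle_tight[OF U] tight_edge by blast
    have "odd (length es') \<Longrightarrow> uncovered (near s U) (last Us')" using w' by simp
    note sw' = switch_along_path[OF cycle_nodes_disjoint card2 w'(1,2,3) near_node_matching[OF U] w'(5) this]
    have hd': "hd Us' \<in> cycle_nodes s U" "hd Us' \<in> set Us'"
      using walk_hd[OF w'(1)] walk_node_in[OF w'(1), of 0] walk_length[OF w'(1)] by auto
    \<comment> \<open>A node off the path that is missed now was missed before, so it would be the
      old missed node \<open>hd Us'\<close>, which is on the path. Hence the missed node has moved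
      to the end of the path.\<close>
    have missed: "W = last Us'" if "W \<in> cycle_nodes s U" "uncovered (N U) W" for W
    proof -
      have "uncovered (sym_diff (near s U) (set es')) W" using that(2) NU w'(6) by simp
      then have "W \<notin> set Us' \<and> uncovered (near s U) W \<or> W = last Us'" using sw'(2)[OF _ that(1)] by blast
      then show ?thesis using near_misses_one[OF U that(1) hd'(1) _ w'(5)] hd'(2) by auto
    qed
    have "N U \<subseteq> cycle s U" using NU near_subset_cycle[OF U] w'(1,6) unfolding walk_def by blast
    moreover have "node_matching (cycle_nodes s U) (N U)" using sw'(1) NU w'(6) by simp
    moreover have "\<forall>W\<in>cycle_nodes s U. \<forall>W'\<in>cycle_nodes s U. uncovered (N U) W \<longrightarrow> uncovered (N U) W' \<longrightarrow> W = W'"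
      using missed by metis
    ultimately show ?thesis by simp
  qed
  have st': "blossom_state V E w s'"
  proof
    show "cmatch s' \<subseteq> tight_edges V E w s'"
      using cmatch_tight wk unfolding same walk_def by blast
    show "node_matching (nodes s') (cmatch s')" using sw(1) unfolding same .
    fix U assume "U \<in> blossoms s'"
    then have U: "U \<in> blossoms s" by (simp add: same)
    show "cycle s' U \<subseteq> tight_edges V E w s'" using cycle_tight[OF U] by (simp add: same)
    show "e \<subseteq> U" if "e \<in> cycle s' U" for e using cycle_inside[OF U] that by (simp add: same)
    show "near s' U \<subseteq> cycle s' U" "node_matching (cycle_nodes s' U) (near s' U)" using near'[OF U] by (simp_all add: same)
    show "W = W'" if "W \<in> cycle_nodes s' U" "W' \<in> cycle_nodes s' U" "uncovered (near s' U) W" "uncovered (near s' U) W'" for W W'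
      using near'[OF U] that by (simp add: same)
    show "uncovered (near s' U) W" if "e \<in> full_matching s'" "e \<in> cut E U" "W \<in> cycle_nodes s' U" "e \<inter> W \<noteq> {}" for e W
      using base[OF U that(1,2) _ that(4)] that(3) by (simp add: same)
  qed (use graph family_odd singleton_in_family family_laminar dual_support feasible in \<open>simp_all add: same\<close>)
  then show "blossom_state V E w s'" .
  interpret s': blossom_state V E w s' by (rule st')
  show "dual s' = dual s" by (simp add: same)
  show "V - \<Union> (full_matching s') \<subseteq> V - \<Union> (full_matching s)"
  proof
    \<comment> \<open>Argue backwards in time: the node \<open>B\<close> of \<open>v\<close> is
      exposed after the augmentation. The odd path leaves none of its own nodes uncovered, so
      \<open>B\<close> is off the path and was uncovered before, and the blossoms inside
      \<open>B\<close> kept their \<open>near\<close>.\<close>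
    fix v assume v: "v \<in> V - \<Union> (full_matching s')"
    then obtain B where B: "B \<in> nodes s" "v \<in> B" using node_containing by blast
    then have "B \<in> exposed_nodes s'" using s'.exposed_vertex_in_exposed_node v same by auto
    then have "B \<notin> set Us \<and> uncovered (cmatch s) B"
      using sw(2)[OF B(1)] s'.exposed_uncovered[of B] exposed_walk_odd[OF ew] unfolding same by blast
    then have B': "B \<notin> set Us" "uncovered (cmatch s) B" by auto
    have "v \<notin> e" if e: "e \<in> full_matching s" for e
      using e
    proof (cases rule: full_matching_cases)
      case 1
      then show ?thesis using B' B by (auto simp: uncovered_def)
    next
      case (2 U)
      show ?thesis
      proof
        assume "v \<in> e"
        then have vU: "v \<in> U" using near_inside[OF 2] by blast
        then have UB: "U \<subseteq> B" using node_contains_member[OF B(1) blossom_in_family[OF 2(1)]] B by blast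
        have "\<not> U \<subseteq> B2" if "B2 \<in> set Us" for B2
        proof
          assume "U \<subseteq> B2"
          moreover have "B2 \<in> nodes s" using that wk by (auto simp: walk_def)
          ultimately have "B2 = B" using nodes_eq[of B2 B] B vU UB by blast
          then show False using that B' by simp
        qed
        then have "N U = near s U" using N2 by blast
        then have "e \<in> full_matching s'" using 2 same by (auto simp: full_matching_def)
        then show False using v \<open>v \<in> e\<close> by blast
      qed
    qed
    then show "v \<in> V - \<Union> (full_matching s)" using v by blast
  qed
qed

section \<open>Shrinking\<close>

text \<open>The closed segment from \<open>i\<close> to \<open>j\<close> is an odd cycle with base
  \<open>Us ! i\<close>. All other nodes of it are matched by edges of \<open>C\<close>, so
  \<open>cmatch s\<close> restricted to \<open>C\<close> misses exactly the base. These edges move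
  from \<open>cmatch\<close> to \<open>near\<close>, which leaves the full matching as it
  was.\<close>

lemma shrink_preserves:
  assumes "shrink_step V E w s s'"
  shows "blossom_state V E w s'" "dual s' = dual s" "full_matching s' = full_matching s"
proof -
  have set_seg: "set (take (b - a) (drop a xs)) = (!) xs ` {a..<b}" if "a < b" "b \<le> length xs" for a b and xs :: "'v set list"
  proof -
    have "take (b - a) (drop a xs) = map ((!) xs) [a..<b]"
      using that by (intro nth_equalityI) auto
    then show ?thesis by simp
  qed
  obtain Us es i j where sew: "shortest_exposed_walk V E w s Us es"
    and ij: "i < j" "j < length Us" "Us ! i = Us ! j" "odd (j - i)"
    and dist: "distinct (take (j - i) (drop i Us))"
    and s'0: "let U = \<Union> (set (take (j - i) (drop i Us)));
             C = set (take (j - i) (drop i es))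
         in s' = s\<lparr>family := insert U (family s), dual := (dual s)(U := 0),
                  cmatch := cmatch s - C,
                  cycle := (cycle s)(U := C), near := (near s)(U := cmatch s \<inter> C)\<rparr>"
    using assms unfolding shrink_step_def by (elim exE conjE) (rule that)
  have ew: "exposed_walk V E w s Us es" using sew by (simp add: shortest_exposed_walk_def)
  have aw: "alt_walk V E w s Us es" and hd: "hd Us \<in> exposed_nodes s" using ew by (auto simp: exposed_walk_def)
  have wk: "walk (nodes s) (tight_edges V E w s) Us es" using aw by (simp add: alt_walk_def)
  note len = walk_length[OF wk]
  have jl: "j \<le> length es" using ij len by simp
  have par: "es ! k \<in> cmatch s \<longleftrightarrow> odd k" if "k < length es" for k
    using exposed_start_parity[OF aw hd that] .
  define U where "U = \<Union> ((!) Us ` {i..<j})"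
  define C where "C = (!) es ` {i..<j}"
  have s': "s' = s\<lparr>family := insert U (family s), dual := (dual s)(U := 0), cmatch := cmatch s - C,
                  cycle := (cycle s)(U := C), near := (near s)(U := cmatch s \<inter> C)\<rparr>"
    using s'0 set_seg[OF ij(1)] ij(2) jl unfolding U_def C_def by (simp add: Let_def)
  have inj: "inj_on ((!) Us) {i..<j}"
  proof -
    have "take (j - i) (drop i Us) = map ((!) Us) [i..<j]" using ij by (intro nth_equalityI) auto
    then show ?thesis using dist by (simp add: distinct_map)
  qed
  have seg_eq: "a = b" if "Us ! a = Us ! b" "a \<in> {i..<j}" "b \<in> {i..<j}" for a b
    using inj_onD[OF inj that] .
  have node: "Us ! k \<in> nodes s" if "k \<le> j" for k using walk_node_in[OF wk] that jl by simp
  have subU: "Us ! k \<subseteq> U" if "k \<in> {i..j}" for k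
  proof -
    have "k \<in> {i..<j} \<or> Us ! k = Us ! i" using that ij(3) by (cases "k = j") auto
    then have "Us ! k \<in> (!) Us ` {i..<j}" using ij(1) by auto
    then show ?thesis unfolding U_def by (rule Union_upper)
  qed
  \<comment> \<open>Consecutive nodes differ, so the odd closed segment does not have length 1; it
    has at least three edges.\<close>
  have ji: "Suc i < j" using walk_edge_ends(1)[OF wk, of i] ij jl by (cases "j = Suc i") auto
  then have ji3: "Suc (Suc i) < j" using ij by (cases "j = Suc (Suc i)") auto
  \<comment> \<open>For odd \<open>i\<close> the first and last edge of the closed segment are the unique matching edge at \<open>Us ! i\<close>,
    so the segment would have length 2.\<close>
  have even_i: "even i"
  proof (rule ccontr)
    assume oi: "odd i"
    obtain k where k: "j = Suc k" using ij by (cases j) auto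
    have k': "odd k" "k < length es" "i < k" using oi ij k ji jl by auto
    have "es ! i = es ! k"
      using node_matching_unique[OF cmatch_node_matching node[of i]] par[of i] par[of k] k k' oi ij
        walk_edge_ends(2)[OF wk, of i] walk_edge_ends(3)[OF wk, of k] by auto
    then have "Us ! k = Us ! i \<or> Us ! k = Us ! Suc i"
      using walk_edge_hits[OF nodes_disjoint tight_edges_card wk, of i "Us ! k"] node[of k] k k'
        walk_edge_ends(2)[OF wk, of k] by auto
    then have "k = i \<or> k = Suc i" using seg_eq[of k i] seg_eq[of k "Suc i"] k k' ji by auto
    then show False using k' ji3 k by auto
  qed
  then have odd_j: "odd j" using ij by auto
  have member: "\<exists>k\<in>{i..<j}. W \<subseteq> Us ! k" if "W \<in> family s" "W \<inter> U \<noteq> {}" for W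
  proof -
    obtain k where "k \<in> {i..<j}" "W \<inter> Us ! k \<noteq> {}" using \<open>W \<inter> U \<noteq> {}\<close> unfolding U_def by blast
    then show ?thesis using node_contains_member[OF node[of k] that(1)] by auto
  qed
  have fam_sub: "W \<subseteq> U" if "W \<in> family s" "W \<inter> U \<noteq> {}" for W
    using member[OF that] subU by fastforce
  have two: "Us ! i \<noteq> {}" "Us ! Suc i \<noteq> {}" "Us ! i \<inter> Us ! Suc i = {}"
  proof -
    show "Us ! i \<noteq> {}" "Us ! Suc i \<noteq> {}" using family_member(4)[OF nodes_in_family] node ij ji by auto
    show "Us ! i \<inter> Us ! Suc i = {}"
      using nodes_eq[OF node[of i] node[of "Suc i"]] walk_edge_ends(1)[OF wk, of i] ij ji jl by auto
  qed
  have U_new: "U \<notin> family s"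
  proof
    assume "U \<in> family s"
    moreover have "U \<inter> U \<noteq> {}" using two subU[of i] ij by auto
    ultimately obtain k where k: "k \<in> {i..<j}" "U \<subseteq> Us ! k" using member by blast
    have "Us ! i \<inter> Us ! k \<noteq> {}" "Us ! Suc i \<inter> Us ! k \<noteq> {}"
      using two k subU[of i] subU[of "Suc i"] ij ji by auto
    then have "Us ! i = Us ! Suc i" using nodes_eq[OF node[of i] node[of k]] nodes_eq[OF node[of "Suc i"] node[of k]] k ij ji by auto
    then show False using two by simp
  qed
  have UV: "U \<subseteq> V"
    unfolding U_def
  proof (rule UN_least)
    show "Us ! k \<subseteq> V" if "k \<in> {i..<j}" for k
      using family_member(1)[OF nodes_in_family[OF node[of k]]] that by simp
  qed
  \<comment> \<open>An odd number of disjoint sets of odd size.\<close>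
  have odd_U: "odd (card U)"
  proof -
    have "card U = sum card ((!) Us ` {i..<j})"
      unfolding U_def
    proof (rule card_Union_disjoint)
      show "pairwise disjnt ((!) Us ` {i..<j})"
        by (rule pairwise_subset[OF nodes_disjoint]) (use node in auto)
      show "finite A" if "A \<in> (!) Us ` {i..<j}" for A
        using that family_member(3)[OF nodes_in_family[OF node]] by auto
    qed
    also have "\<dots> = (\<Sum>k\<in>{i..<j}. card (Us ! k))" using inj by (simp add: sum.reindex)
    finally have c: "card U = (\<Sum>k\<in>{i..<j}. card (Us ! k))" .
    have "{k \<in> {i..<j}. odd (card (Us ! k))} = {i..<j}"
      using family_member(2)[OF nodes_in_family[OF node]] by auto
    then show ?thesis unfolding c using even_sum_iff[of "{i..<j}" "\<lambda>k. card (Us ! k)"] ij by simp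
  qed
  have card_U: "3 \<le> card U"
  proof -
    have "card U \<noteq> 1"
    proof
      assume "card U = 1"
      then obtain x where "U = {x}" by (auto simp: card_1_singleton_iff)
      then show False using two subU[of i] subU[of "Suc i"] ij ji by auto
    qed
    then show ?thesis using odd_U by presburger
  qed
  have C_sub: "e \<subseteq> U" if eC: "e \<in> C" for e
  proof -
    obtain k where k: "e = es ! k" "i \<le> k" "k < j" using eC by (auto simp: C_def)
    have kl: "k < length es" using k jl by simp
    note en = walk_edge_ends[OF wk kl]
    have "Us ! k \<inter> Us ! Suc k = {}" using nodes_eq[OF node[of k] node[of "Suc k"]] en(1) k by auto
    then have "e \<subseteq> Us ! k \<union> Us ! Suc k"
      using edge_meets_disjoint(2)[OF _ _ en(2,3)] tight_edges_card walk_edge_in[OF wk kl] k by auto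
    then show ?thesis using subU[of k] subU[of "Suc k"] k by auto
  qed
  have C_tight: "C \<subseteq> tight_edges V E w s" using walk_edge_in[OF wk] jl by (auto simp: C_def)
  \<comment> \<open>One of the positions \<open>k - 1\<close> and \<open>k\<close> is odd and
    carries a matching edge. Both positions lie in the segment because \<open>k\<close> is strictly
    between \<open>i\<close> and \<open>j\<close>.\<close>
  have covered: "\<exists>e\<in>cmatch s \<inter> C. e \<inter> Us ! k \<noteq> {}" if k: "i < k" "k < j" for k
  proof (cases "odd k")
    case True
    then show ?thesis using k jl par[of k] walk_edge_ends(2)[OF wk, of k] by (auto simp: C_def)
  next
    case False
    then obtain m where m: "k = Suc m" using k by (cases k) auto
    then have "odd m" "i \<le> m" "m < j" "m < length es" using False k jl even_i by auto
    then show ?thesis using m par[of m] walk_edge_ends(3)[OF wk, of m] by (auto simp: C_def)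
  qed
  have hit_i: "k = i" if e: "e \<in> cmatch s" "e \<notin> C" "e \<inter> Us ! k \<noteq> {}" and k: "k \<in> {i..<j}" for e k
  proof (rule ccontr)
    assume "k \<noteq> i"
    then obtain f where "f \<in> cmatch s" "f \<in> C" "f \<inter> Us ! k \<noteq> {}" using covered[of k] k by auto
    then show False using node_matching_unique[OF cmatch_node_matching node[of k]] e k by auto
  qed
  have cm_i: "e \<inter> U \<subseteq> Us ! i" if "e \<in> cmatch s" "e \<notin> C" for e
    using hit_i[OF that] unfolding U_def by blast
  \<comment> \<open>Within the segment only positions \<open>i\<close> and \<open>j - 1\<close> meet
    the base. Both are even, as \<open>i\<close> is even and \<open>j\<close> odd, so their edges
    are unmatched.\<close>
  have base_unc: "uncovered (cmatch s \<inter> C) (Us ! i)"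
    unfolding uncovered_def
  proof (intro ballI, rule ccontr)
    fix e assume e: "e \<in> cmatch s \<inter> C" "e \<inter> Us ! i \<noteq> {}"
    then obtain k where "e = es ! k" "k \<in> {i..<j}" unfolding C_def by blast
    then have k: "e = es ! k" "i \<le> k" "k < j" by auto
    then have ok: "odd k" using par[of k] e jl by auto
    have "Us ! i = Us ! k \<or> Us ! i = Us ! Suc k"
      using walk_edge_hits[OF nodes_disjoint tight_edges_card wk, of k "Us ! i"] node[of i] e k ij jl by auto
    moreover have "Us ! i \<noteq> Us ! k" using seg_eq[of i k] k ok even_i by auto
    moreover have "Us ! i \<noteq> Us ! Suc k" using seg_eq[of i "Suc k"] k ok odd_j by (cases "Suc k = j") auto
    ultimately show False by blast
  qed
  \<comment> \<open>\<open>U\<close> is new to the family, so its dual value was already 0 and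
    resetting it changes no load.\<close>
  have same: "dual s' = dual s" "tight_edges V E w s' = tight_edges V E w s"
    "blossoms s' = insert U (blossoms s)" "family s' = insert U (family s)" "cmatch s' = cmatch s - C"
    "cycle s' = (cycle s)(U := C)" "near s' = (near s)(U := cmatch s \<inter> C)"
    using dual_support[OF U_new] card_U by (auto simp: s' tight_edges_def blossoms_def fun_upd_idem)
  have old: "U' \<noteq> U" if "U' \<in> blossoms s" for U' using that U_new blossom_in_family by blast
  have near_image: "\<Union> (near s' ` blossoms s) = \<Union> (near s ` blossoms s)"
    using old by (auto simp: same)
  have full: "full_matching s' = full_matching s"
    unfolding full_matching_def same(3) using near_image by (auto simp: same(5,7))
  have nodes': "B = U \<or> B \<in> nodes s" if B: "B \<in> nodes s'" for B
  proof (cases "B = U")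
    case False
    then have BF: "B \<in> family s" and mx: "\<And>W. W \<in> family s \<Longrightarrow> \<not> B \<subset> W"
      using B by (auto simp: nodes_def maximal_sets_def same)
    then show ?thesis by (auto simp: nodes_def maximal_sets_def)
  qed simp
  have cyc_old: "cycle_nodes s' U' = cycle_nodes s U'" if "U' \<in> blossoms s" for U'
  proof -
    have "\<not> U \<subset> U'"
    proof
      assume "U \<subset> U'"
      moreover have "U \<noteq> {}" using card_U by auto
      ultimately have "U' \<subseteq> U" using fam_sub[OF blossom_in_family[OF that]] by blast
      then show False using \<open>U \<subset> U'\<close> by blast
    qed
    then have "{W \<in> family s'. W \<subset> U'} = {W \<in> family s. W \<subset> U'}" by (auto simp: same)
    then show ?thesis by (simp add: cycle_nodes_def)
  qed
  have cyc_new: "\<exists>k\<in>{i..<j}. W = Us ! k" if W: "W \<in> cycle_nodes s' U" for W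
  proof -
    have WF: "W \<in> family s" "W \<subset> U" and mx: "\<And>X. X \<in> family s \<Longrightarrow> X \<subset> U \<Longrightarrow> \<not> W \<subset> X"
      using W by (auto simp: cycle_nodes_def maximal_sets_def same)
    have "W \<inter> U \<noteq> {}" using WF family_member(4)[OF WF(1)] by blast
    then obtain k where k: "k \<in> {i..<j}" "W \<subseteq> Us ! k" using member[OF WF(1)] by blast
    have kf: "Us ! k \<in> family s" using nodes_in_family[OF node[of k]] k by auto
    then have "Us ! k \<subset> U" using subU[of k] k U_new by auto
    then have "W = Us ! k" using mx[OF kf] k by blast
    then show ?thesis using k by blast
  qed
  show "dual s' = dual s" by (rule same)
  show "full_matching s' = full_matching s" by (rule full)
  show "blossom_state V E w s'"
  proof
    show "family s' \<subseteq> odd_sets V" using family_odd UV odd_U by (auto simp: same odd_sets_def)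
    show "{v} \<in> family s'" if "v \<in> V" for v using singleton_in_family[OF that] by (simp add: same)
    show "laminar (family s')"
      unfolding laminar_def same
    proof (intro ballI)
      fix A B assume "A \<in> insert U (family s)" "B \<in> insert U (family s)"
      then consider "A = U" "B = U" | "A = U" "B \<in> family s" | "B = U" "A \<in> family s" | "A \<in> family s" "B \<in> family s"
        by blast
      then show "A \<inter> B = {} \<or> A \<subseteq> B \<or> B \<subseteq> A"
        by cases (use fam_sub family_nested in blast)+
    qed
    show "dual s' U' = 0" if "U' \<notin> family s'" for U' using dual_support that by (simp add: same)
    show "dual_feasible V E w (dual s')" using feasible by (simp add: same)
    show "cmatch s' \<subseteq> tight_edges V E w s'" using cmatch_tight by (auto simp: same)
    show "node_matching (nodes s') (cmatch s')"
      unfolding node_matching_def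
    proof (intro ballI conjI impI)
      fix B e assume B: "B \<in> nodes s'" and e: "e \<in> cmatch s'"
      have e': "e \<in> cmatch s" "e \<notin> C" using e by (auto simp: same)
      show "\<not> e \<subseteq> B"
        using nodes'[OF B]
      proof
        assume "B = U"
        then show ?thesis using cm_i[OF e'] node_matching_not_inside[OF cmatch_node_matching node[of i] e'(1)] ij by auto
      qed (use node_matching_not_inside[OF cmatch_node_matching _ e'(1)] in blast)
      fix f assume f: "f \<in> cmatch s'" and h: "e \<inter> B \<noteq> {}" "f \<inter> B \<noteq> {}"
      have f': "f \<in> cmatch s" "f \<notin> C" using f by (auto simp: same)
      show "e = f"
        using nodes'[OF B]
      proof
        assume "B = U"
        then have "e \<inter> Us ! i \<noteq> {}" "f \<inter> Us ! i \<noteq> {}" using cm_i[OF e'] cm_i[OF f'] h by auto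
        then show ?thesis using node_matching_unique[OF cmatch_node_matching node[of i] e'(1) f'(1)] ij by auto
      qed (use node_matching_unique[OF cmatch_node_matching _ e'(1) f'(1)] h in blast)
    qed
    fix U' assume "U' \<in> blossoms s'"
    then have U': "U' = U \<or> U' \<in> blossoms s" by (simp add: same)
    show "cycle s' U' \<subseteq> tight_edges V E w s'" using U' C_tight cycle_tight old by (auto simp: same)
    show "e \<subseteq> U'" if "e \<in> cycle s' U'" for e using U' C_sub cycle_inside old that by (auto simp: same split: if_splits)
    show "near s' U' \<subseteq> cycle s' U'" using U' near_subset_cycle old by (auto simp: same)
    show "node_matching (cycle_nodes s' U') (near s' U')"
      using U'
    proof
      assume "U' \<in> blossoms s"
      then show ?thesis using near_node_matching cyc_old old by (simp add: same)
    next
      assume "U' = U"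
      moreover have "cycle_nodes s' U \<subseteq> nodes s" using cyc_new node by fastforce
      ultimately show ?thesis using node_matching_mono[OF cmatch_node_matching, of _ "cmatch s \<inter> C"] by (simp add: same(7))
    qed
    have unc_i: "W = Us ! i" if W: "W \<in> cycle_nodes s' U" "uncovered (cmatch s \<inter> C) W" for W
    proof -
      obtain k where k: "k \<in> {i..<j}" "W = Us ! k" using cyc_new[OF W(1)] by blast
      then show ?thesis using covered[of k] W(2) by (cases "k = i") (auto simp: uncovered_def)
    qed
    show "W = W'" if "W \<in> cycle_nodes s' U'" "W' \<in> cycle_nodes s' U'"
      "uncovered (near s' U') W" "uncovered (near s' U') W'" for W W'
      using U'
    proof
      assume "U' \<in> blossoms s"
      then show ?thesis using near_misses_one[of U' W W'] that cyc_old old by (simp add: same)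
    next
      assume "U' = U"
      then show ?thesis using unc_i[of W] unc_i[of W'] that by (simp add: same)
    qed
    show "uncovered (near s' U') W" if e: "e \<in> full_matching s'" "e \<in> cut E U'" and W: "W \<in> cycle_nodes s' U'" "e \<inter> W \<noteq> {}" for e W
      using U'
    proof
      assume "U' \<in> blossoms s"
      then show ?thesis using leaving_edge_base[of U' e W] e W full cyc_old old by (simp add: same)
    next
      assume UU: "U' = U"
      then obtain k where k: "k \<in> {i..<j}" "W = Us ! k" using cyc_new W by blast
      have ef: "e \<in> full_matching s" using e full by simp
      have "card e = 2" using full_matching_tight tight_edge(3) ef by blast
      then have nsub: "\<not> e \<subseteq> U" using e UU by (auto simp: cut_def inf.absorb1)
      \<comment> \<open>A blossom meeting \<open>U\<close> lies inside \<open>U\<close>, so an edge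
        leaving \<open>U\<close> that meets \<open>W\<close> is not recorded in any
        \<open>near\<close>. It is an edge of \<open>cmatch\<close> outside \<open>C\<close>, and
        such an edge can meet \<open>U\<close> only in the base.\<close>
      from ef have "e \<in> cmatch s \<and> e \<notin> C"
      proof (cases rule: full_matching_cases)
        case 1
        then show ?thesis using nsub C_sub by blast
      next
        case (2 U2)
        have "U2 \<inter> U \<noteq> {}" using near_inside[OF 2] W k subU[of k] by auto
        then have "U2 \<subseteq> U" using fam_sub[OF blossom_in_family[OF 2(1)]] by blast
        then show ?thesis using near_inside[OF 2] nsub by blast
      qed
      then have "k = i" using hit_i W k by blast
      then show ?thesis using base_unc k UU by (simp add: same)
    qed
  qed (rule graph)
qed

end

section \<open>Dual updates\<close>

context blossom_state
begin

lemma exposed_subset_outer: "exposed_nodes s \<subseteq> outer_nodes V E w s"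
proof
  fix B assume B: "B \<in> exposed_nodes s"
  then have "alt_walk V E w s [B] []"
    by (simp add: alt_walk_def walk_def alternating_def exposed_nodes_def)
  then show "B \<in> outer_nodes V E w s"
    unfolding outer_nodes_def using B by (intro CollectI exI[of _ "[B]"] exI[of _ "[]"]) simp
qed

lemma outer_inner_subset_nodes: "outer_nodes V E w s \<union> inner_nodes V E w s \<subseteq> nodes s"
proof -
  have "last Us \<in> nodes s" if aw: "alt_walk V E w s Us es" for Us es
  proof -
    have wk: "walk (nodes s) (tight_edges V E w s) Us es" using aw by (simp add: alt_walk_def)
    show ?thesis using walk_last[OF wk] walk_node_in[OF wk] by simp
  qed
  then show ?thesis unfolding outer_nodes_def inner_nodes_def by blast
qed

text \<open>Following the even walk to \<open>B\<close> and then the odd one backwards gives an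
  alternating walk between exposed nodes: the even one is empty or arrives at \<open>B\<close> by a
  matching edge, the odd one by a non-matching edge. Both may start at the same exposed node, which
  \<open>exposed_walk\<close> admits.\<close>

lemma outer_inner_disjoint:
  assumes none: "\<nexists>Us es. exposed_walk V E w s Us es" and out: "B \<in> outer_nodes V E w s"
  shows "B \<notin> inner_nodes V E w s"
proof
  assume "B \<in> inner_nodes V E w s"
  then obtain Us' es' where a': "alt_walk V E w s Us' es'" "odd (length es')" "hd Us' \<in> exposed_nodes s" "last Us' = B"
    unfolding inner_nodes_def by blast
  obtain Us es where a: "alt_walk V E w s Us es" "even (length es)" "hd Us \<in> exposed_nodes s" "last Us = B"
    using out unfolding outer_nodes_def by blast
  have wk: "walk (nodes s) (tight_edges V E w s) Us es" and wk': "walk (nodes s) (tight_edges V E w s) Us' es'"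
    using a(1) a'(1) by (simp_all add: alt_walk_def)
  have ne: "Us \<noteq> []" "Us' \<noteq> []" "es' \<noteq> []" using walk_length[OF wk] walk_length[OF wk'] a'(2) by auto
  let ?Us = "Us @ tl (rev Us')" and ?es = "es @ rev es'"
  have wk2: "walk (nodes s) (tight_edges V E w s) ?Us ?es"
    by (rule walk_append[OF wk walk_rev[OF wk']]) (use a a' ne in \<open>simp add: hd_rev\<close>)
  have "alternating (cmatch s) ?es"
  proof (rule alternatingI)
    fix i assume i: "i < length ?es"
    show "?es ! i \<in> cmatch s \<longleftrightarrow> odd i"
    proof (cases "i < length es")
      case True
      then show ?thesis using exposed_start_parity[OF a(1,3) True] by (simp add: nth_append)
    next
      case False
      define k where "k = length es' - Suc (i - length es)"
      have k: "k < length es'" "?es ! i = es' ! k" using False i by (auto simp: k_def nth_append rev_nth)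
      \<comment> \<open>Reversal keeps the parity of positions because \<open>length es\<close> is
        even and \<open>length es'\<close> is odd.\<close>
      have "odd k \<longleftrightarrow> odd i" using False i a(2) a'(2) by (auto simp: k_def)
      then show ?thesis using exposed_start_parity[OF a'(1,3) k(1)] k(2) by simp
    qed
  qed
  moreover have "last ?Us = hd Us'"
  proof -
    obtain x xs where xs: "rev Us' = x # xs" using ne by (cases "rev Us'") auto
    then have "x = last Us" using a(4) a'(4) hd_rev[of Us'] by simp
    then have "last (Us @ tl (rev Us')) = last (rev Us')" using xs ne by (cases xs) auto
    then show ?thesis using ne by (simp add: last_rev)
  qed
  ultimately have "exposed_walk V E w s ?Us ?es"
    using wk2 a a' ne by (simp add: exposed_walk_def alt_walk_def)
  then show False using none by blast
qed

text \<open>\<open>B\<close> is matched, so it is not exposed and the even path to it is nonempty.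
  Its last edge is a matching edge at \<open>B\<close>, hence \<open>e\<close>; deleting it leaves
  an odd path to \<open>B'\<close>.\<close>

lemma matched_to_outer_is_inner:
  assumes e: "e \<in> cmatch s" "e \<inter> B \<noteq> {}" "e \<inter> B' \<noteq> {}" and B: "B \<in> nodes s" "B' \<in> nodes s" "B \<noteq> B'"
    and out: "B \<in> outer_nodes V E w s"
  shows "B' \<in> inner_nodes V E w s"
proof -
  obtain Us es where a: "alt_walk V E w s Us es" "distinct Us" "even (length es)" "hd Us \<in> exposed_nodes s" "last Us = B"
    using out unfolding outer_nodes_def by blast
  have wk: "walk (nodes s) (tight_edges V E w s) Us es" and alt: "alternating (cmatch s) es"
    using a(1) by (simp_all add: alt_walk_def)
  have nexp: "\<not> uncovered (cmatch s) B" using e by (auto simp: uncovered_def)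
  have "length es \<noteq> 0"
  proof
    assume "length es = 0"
    then have "hd Us = B" using walk_hd[OF wk] walk_last[OF wk] a(5) by simp
    then show False using exposed_uncovered a(4) nexp by simp
  qed
  then obtain k where k: "length es = Suc k" by (cases "length es") auto
  have "es ! k \<in> cmatch s" using exposed_start_parity[OF a(1,4), of k] k a(3) by simp
  then have "e = es ! k"
    using node_matching_unique[OF cmatch_node_matching B(1) e(1)] e(2) walk_edge_ends(3)[OF wk, of k] walk_last[OF wk] k a(5)
    by simp
  then have B': "B' = Us ! k"
    using walk_edge_hits[OF nodes_disjoint tight_edges_card wk, of k B'] B e(3) k walk_last[OF wk] a(5) by auto
  have es: "es \<noteq> []" and Us: "length Us = Suc (Suc k)" using k walk_length[OF wk] by auto
  have "last (butlast Us) = Us ! k"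
    using Us by (subst last_conv_nth) (auto simp: nth_butlast simp flip: length_greater_0_conv)
  moreover have "hd (butlast Us) = hd Us" using Us by (cases Us) auto
  moreover have "alternating (cmatch s) (butlast es)" using alt by (simp add: alternating_def nth_butlast)
  ultimately show ?thesis
    unfolding inner_nodes_def
    using walk_butlast[OF wk es] a B' k
    by (intro CollectI exI[of _ "butlast Us"] exI[of _ "butlast es"]) (simp add: alt_walk_def distinct_butlast)
qed

text \<open>Append \<open>e\<close> to the odd path. The point is that \<open>B'\<close> is not yet
  on it: otherwise the matching edge at \<open>B'\<close> would be a path edge, and being
  \<open>e\<close> it would meet the end \<open>B\<close>, so it would be the last edge of the path;
  but that edge is unmatched.\<close>

lemma matched_to_inner_is_outer:
  assumes e: "e \<in> cmatch s" "e \<inter> B \<noteq> {}" "e \<inter> B' \<noteq> {}" and B: "B \<in> nodes s" "B' \<in> nodes s" "B \<noteq> B'"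
    and inn: "B \<in> inner_nodes V E w s"
  shows "B' \<in> outer_nodes V E w s"
proof -
  obtain Us es where a: "alt_walk V E w s Us es" "distinct Us" "odd (length es)" "hd Us \<in> exposed_nodes s" "last Us = B"
    using inn unfolding inner_nodes_def by blast
  have wk: "walk (nodes s) (tight_edges V E w s) Us es"
    using a(1) by (simp_all add: alt_walk_def)
  note len = walk_length[OF wk] and par = exposed_start_parity[OF a(1,4)]
  have lastB: "Us ! length es = B" using walk_last[OF wk] a(5) by simp
  have fresh: "B' \<notin> set Us"
  proof
    assume "B' \<in> set Us"
    then obtain k where k: "k < length Us" "Us ! k = B'" by (auto simp: in_set_conv_nth)
    have kl: "k < length es" using k len lastB B(3) by (cases "k = length es") auto
    have e_hit: "m = k \<and> Suc m = length es \<or> Suc m = k \<and> m = length es" if m: "m < length es" "e = es ! m" for m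
    proof -
      have "B = Us ! m \<or> B = Us ! Suc m" "B' = Us ! m \<or> B' = Us ! Suc m"
        using walk_edge_hits[OF nodes_disjoint tight_edges_card wk m(1)] B e m(2) by blast+
      then have "length es = m \<or> length es = Suc m" "k = m \<or> k = Suc m"
        using a(2) k m len lastB by (auto simp: nth_eq_iff_index_eq[symmetric])
      then show ?thesis using m kl by auto
    qed
    show False
    proof (cases "odd k")
      case True
      have "e = es ! k"
        using node_matching_unique[OF cmatch_node_matching B(2) e(1) _ e(3)] par[OF kl] True walk_edge_ends(2)[OF wk kl] k by simp
      then have "Suc k = length es" using e_hit[OF kl] by auto
      then show False using True a(3) by (metis even_Suc)
    next
      case False
      show False
      proof (cases k)
        case 0
        then have "uncovered (cmatch s) B'" using walk_hd[OF wk] exposed_uncovered[OF a(4)] k by simp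
        then show False using e by (auto simp: uncovered_def)
      next
        case (Suc m)
        have m: "m < length es" "odd m" using Suc kl False by auto
        have "e = es ! m"
          using node_matching_unique[OF cmatch_node_matching B(2) e(1) _ e(3)] par[OF m(1)] m walk_edge_ends(3)[OF wk m(1)] k Suc by simp
        then show False using e_hit[OF m(1)] m Suc kl by auto
      qed
    qed
  qed
  have wk1: "walk (nodes s) (tight_edges V E w s) [B, B'] [e]" using e B cmatch_tight by (auto simp: walk_def)
  have "walk (nodes s) (tight_edges V E w s) (Us @ [B']) (es @ [e])" using walk_append[OF wk wk1] a(5) by simp
  moreover have "alternating (cmatch s) (es @ [e])"
  proof (rule alternatingI)
    fix i assume "i < length (es @ [e])"
    then show "(es @ [e]) ! i \<in> cmatch s \<longleftrightarrow> odd i"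
      using par[of i] e(1) a(3) by (cases "i = length es") (auto simp: nth_append)
  qed
  moreover have "hd (Us @ [B']) = hd Us" using len by (cases Us) auto
  ultimately show ?thesis
    unfolding outer_nodes_def using a fresh
    by (intro CollectI exI[of _ "Us @ [B']"] exI[of _ "es @ [e]"]) (simp add: alt_walk_def)
qed

end

section \<open>Loads, potentials and deshrinking under a uniform dual change\<close>

locale dual_change = blossom_state +
  fixes y :: "'a set \<Rightarrow> real" and \<delta> :: real
  assumes \<delta>_nonneg: "0 \<le> \<delta>"
    and y_outer: "U \<in> outer_nodes V E w s \<Longrightarrow> y U = dual s U + \<delta>"
    and y_inner: "U \<in> inner_nodes V E w s \<Longrightarrow> y U = dual s U - \<delta>"
    and y_other: "U \<notin> outer_nodes V E w s \<Longrightarrow> U \<notin> inner_nodes V E w s \<Longrightarrow> y U = dual s U"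
begin

lemma y_not_node: "U \<notin> nodes s \<Longrightarrow> y U = dual s U"
  using y_other outer_inner_subset_nodes by blast

text \<open>Only maximal sets change value, and an edge inside one of them is cut by none. This
  keeps the cycles of all blossoms tight.\<close>

lemma load_inside_node:
  assumes B: "B \<in> nodes s" and e: "e \<subseteq> B" "card e = 2"
  shows "dual_load V E y e = dual_load V E (dual s) e"
  unfolding dual_load_def
proof (rule sum.cong)
  fix U assume "U \<in> {U. U \<in> odd_sets V \<and> e \<in> cut E U}"
  then have c: "card (e \<inter> U) = 1" by (simp add: cut_def)
  have "U \<notin> nodes s"
  proof
    assume U: "U \<in> nodes s"
    have "e \<inter> U \<noteq> {}" using c by auto
    then have "U = B" using nodes_eq[OF U B] e by blast
    then show False using c e by (simp add: inf.absorb1)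
  qed
  then show "y U = dual s U" by (rule y_not_node)
qed simp

text \<open>Among the sets cut by \<open>e\<close> only the two nodes at its ends can change. One of
  them is outer and the other inner, with opposite changes, or neither is reached.\<close>

lemma load_cmatch:
  assumes e: "e \<in> cmatch s"
  shows "dual_load V E y e = dual_load V E (dual s) e"
proof -
  have et: "e \<in> E" "e \<subseteq> V" "card e = 2" using e cmatch_tight tight_edge by blast+
  obtain a b where ab: "e = {a, b}" "a \<noteq> b" using et(3) by (auto simp: card_2_iff)
  obtain A where A: "A \<in> nodes s" "a \<in> A" using node_containing[of a] et ab by blast
  obtain B where B: "B \<in> nodes s" "b \<in> B" using node_containing[of b] et ab by blast
  have AB: "A \<noteq> B" using node_matching_not_inside[OF cmatch_node_matching A(1) e] A B ab by blast
  have disj: "A \<inter> B = {}" using nodes_eq[OF A(1) B(1)] AB by blast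
  have hit: "e \<inter> A \<noteq> {}" "e \<inter> B \<noteq> {}" using A B ab by auto
  have ch: "(y A - dual s A) + (y B - dual s B) = 0"
    using matched_to_outer_is_inner[OF e hit A(1) B(1) AB] matched_to_inner_is_outer[OF e hit A(1) B(1) AB]
      matched_to_outer_is_inner[OF e hit(2,1) B(1) A(1) AB[symmetric]]
      matched_to_inner_is_outer[OF e hit(2,1) B(1) A(1) AB[symmetric]]
      y_outer[of A] y_outer[of B] y_inner[of A] y_inner[of B] y_other[of A] y_other[of B]
    by (smt (verit))
  have fin: "finite (odd_sets V)" using finite_odd_sets[OF finite_V] .
  have "dual_load V E y e - dual_load V E (dual s) e = (\<Sum>U | U \<in> odd_sets V \<and> e \<in> cut E U. y U - dual s U)"
    by (simp add: dual_load_def sum_subtractf)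
  also have "\<dots> = (\<Sum>U\<in>{A, B}. y U - dual s U)"
  proof (rule sum.mono_neutral_right)
    show "finite {U. U \<in> odd_sets V \<and> e \<in> cut E U}" using fin by simp
    have "card (e \<inter> A) = 1" "card (e \<inter> B) = 1"
      using edge_meets_disjoint(1)[OF et(3) disj hit] edge_meets_disjoint(1)[OF et(3) _ hit(2,1)] disj by auto
    then show "{A, B} \<subseteq> {U. U \<in> odd_sets V \<and> e \<in> cut E U}"
      using nodes_in_family A B family_odd et by (auto simp: cut_def)
    show "\<forall>U\<in>{U. U \<in> odd_sets V \<and> e \<in> cut E U} - {A, B}. y U - dual s U = 0"
    proof
      fix U assume U: "U \<in> {U. U \<in> odd_sets V \<and> e \<in> cut E U} - {A, B}"
      then have "card (e \<inter> U) = 1" by (simp add: cut_def)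
      then have "e \<inter> U \<noteq> {}" by auto
      then have "a \<in> U \<or> b \<in> U" using ab by auto
      then have "U \<notin> nodes s" using nodes_eq[of U A] nodes_eq[of U B] A B U by blast
      then show "y U - dual s U = 0" using y_not_node by simp
    qed
  qed
  also have "\<dots> = 0" using AB ch by simp
  finally show ?thesis by simp
qed

lemma potential_change:
  assumes B: "B \<in> nodes s" and v: "v \<in> B"
  shows "vertex_potential V y v = vertex_potential V (dual s) v + (y B - dual s B)"
proof -
  have fin: "finite (odd_sets V)" using finite_odd_sets[OF finite_V] .
  have "vertex_potential V y v - vertex_potential V (dual s) v = (\<Sum>U | U \<in> odd_sets V \<and> v \<in> U. y U - dual s U)"
    by (simp add: vertex_potential_def sum_subtractf)
  also have "\<dots> = (\<Sum>U\<in>{B}. y U - dual s U)"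
  proof (rule sum.mono_neutral_right)
    show "finite {U. U \<in> odd_sets V \<and> v \<in> U}" using fin by simp
    show "{B} \<subseteq> {U. U \<in> odd_sets V \<and> v \<in> U}" using B v nodes_in_family family_odd by blast
    show "\<forall>U\<in>{U. U \<in> odd_sets V \<and> v \<in> U} - {B}. y U - dual s U = 0"
    proof
      fix U assume U: "U \<in> {U. U \<in> odd_sets V \<and> v \<in> U} - {B}"
      then have "U \<notin> nodes s" using nodes_eq[of U B] B v by blast
      then show "y U - dual s U = 0" using y_not_node by simp
    qed
  qed
  finally show ?thesis by simp
qed

lemma potential_change_le:
  assumes "v \<in> V" shows "vertex_potential V y v \<le> vertex_potential V (dual s) v + \<delta>"
proof -
  obtain B where B: "B \<in> nodes s" "v \<in> B" using node_containing[OF assms] .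
  then show ?thesis using potential_change[OF B] y_outer[of B] y_inner[of B] y_other[of B] \<delta>_nonneg by force
qed

lemma potential_change_exposed:
  assumes "v \<in> V" "v \<notin> \<Union> (full_matching s)"
  shows "vertex_potential V y v = vertex_potential V (dual s) v + \<delta>"
proof -
  obtain B where B: "B \<in> nodes s" "v \<in> B" using node_containing[OF assms(1)] .
  then have "B \<in> outer_nodes V E w s"
    using exposed_vertex_in_exposed_node assms(2) exposed_subset_outer by blast
  then show ?thesis using potential_change[OF B] y_outer[of B] by simp
qed

text \<open>Dissolving \<open>U\<close> moves \<open>near s U\<close> from the recorded matchings
  into \<open>cmatch\<close>, so the full matching is unchanged, and the cycle nodes of
  \<open>U\<close> become maximal. A \<open>cmatch\<close> edge from outside enters \<open>U\<close>
  at a node missed by \<open>near s U\<close>, so these edges do not collide.\<close>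

lemma deshrink_preserves:
  assumes feas: "dual_feasible V E w y" and D: "D = {U \<in> nodes s. 3 \<le> card U \<and> y U = 0}"
    and s': "s' = s\<lparr>family := family s - D, dual := y, cmatch := cmatch s \<union> \<Union> (near s ` D)\<rparr>"
  shows "blossom_state V E w s'" "full_matching s' = full_matching s"
proof -
  have same: "family s' = family s - D" "dual s' = y" "cmatch s' = cmatch s \<union> \<Union> (near s ` D)"
    "cycle s' = cycle s" "near s' = near s" "blossoms s' = blossoms s - D"
    by (auto simp: s' blossoms_def)
  have D_node: "U \<in> nodes s" if "U \<in> D" for U using that D by simp
  have D_bl: "D \<subseteq> blossoms s" using D nodes_in_family by (auto simp: blossoms_def)
  show full: "full_matching s' = full_matching s"
    using D_bl by (auto simp: full_matching_def same)
  have cyc: "cycle_nodes s' U = cycle_nodes s U" if "U \<in> family s" for U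
  proof -
    have "{W \<in> family s'. W \<subset> U} = {W \<in> family s. W \<subset> U}"
      using that D_node by (auto simp: same nodes_def maximal_sets_def)
    then show ?thesis by (simp add: cycle_nodes_def)
  qed
  have tight_cmatch: "cmatch s \<subseteq> tight_edges V E w s'"
    using cmatch_tight load_cmatch by (auto simp: tight_edges_def same)
  have tight_cycle: "cycle s U \<subseteq> tight_edges V E w s'" if U: "U \<in> blossoms s" for U
  proof
    fix e assume e: "e \<in> cycle s U"
    then have et: "e \<in> tight_edges V E w s" using cycle_tight[OF U] by blast
    obtain B where B: "B \<in> nodes s" "U \<subseteq> B" using node_above[OF blossom_in_family[OF U]] .
    then have "e \<subseteq> B" using cycle_inside[OF U e] by blast
    then show "e \<in> tight_edges V E w s'"
      using load_inside_node[OF B(1) _ tight_edge(3)[OF et]] tight_edge(1,4)[OF et] by (simp add: tight_edges_def same)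
  qed
  \<comment> \<open>Exactly one level is removed: \<open>D\<close> contains maximal sets only, so
    the cycle nodes of a dissolved set stay in the family.\<close>
  have nodes': "B \<in> nodes s - D \<or> (\<exists>U\<in>D. B \<in> cycle_nodes s U)" if B: "B \<in> nodes s'" for B
  proof -
    have BF: "B \<in> family s" "B \<notin> D" and mx: "\<And>W. W \<in> family s \<Longrightarrow> W \<notin> D \<Longrightarrow> \<not> B \<subset> W"
      using B by (auto simp: nodes_def maximal_sets_def same)
    obtain B0 where B0: "B0 \<in> nodes s" "B \<subseteq> B0" using node_above[OF BF(1)] .
    show ?thesis
    proof (cases "B0 \<in> D")
      case False
      then have "B = B0" using mx[OF nodes_in_family[OF B0(1)]] B0(2) by blast
      then show ?thesis using B0 BF by simp
    next
      case True
      then have "B \<subset> B0" using B0 BF by blast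
      then obtain W where W: "W \<in> cycle_nodes s B0" "B \<subseteq> W" using cycle_node_above[OF BF(1)] by blast
      note WF = cycle_nodes_in_family[OF W(1)]
      have "W \<notin> D" using WF(2) D_node[of W] nodes_in_family[OF B0(1)] by (auto simp: nodes_def maximal_sets_def)
      then have "B = W" using mx[OF WF(1)] W(2) by blast
      then show ?thesis using W True by blast
    qed
  qed
  have D_part: "e \<in> near s U" if e: "e \<in> cmatch s'" "e \<inter> U \<noteq> {}" "U \<in> D" "e \<notin> cmatch s" for e U
  proof -
    obtain U2 where U2: "U2 \<in> D" "e \<in> near s U2" using e(1,4) by (auto simp: same)
    then have "e \<subseteq> U2" using near_inside D_bl by blast
    then have "U2 = U" using nodes_eq[OF D_node D_node] U2(1) e(2,3) by blast
    then show ?thesis using U2 by simp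
  qed
  show "blossom_state V E w s'"
  proof
    show "family s' \<subseteq> odd_sets V" using family_odd by (auto simp: same)
    show "{v} \<in> family s'" if "v \<in> V" for v using singleton_in_family[OF that] D by (simp add: same)
    show "laminar (family s')" using family_laminar by (auto simp: same laminar_def)
    show "dual s' U = 0" if "U \<notin> family s'" for U
    proof (cases "U \<in> D")
      case True
      then show ?thesis using D by (simp add: same)
    next
      case False
      then have "U \<notin> family s" using that by (simp add: same)
      then show ?thesis using y_not_node[of U] dual_support[of U] nodes_in_family[of U] by (auto simp: same)
    qed
    show "dual_feasible V E w (dual s')" using feas by (simp add: same)
    show "cmatch s' \<subseteq> tight_edges V E w s'"
      using tight_cmatch tight_cycle near_subset_cycle D_bl by (fastforce simp: same)
    show "node_matching (nodes s') (cmatch s')"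
      unfolding node_matching_def
    proof (intro ballI conjI impI)
      fix B e assume B: "B \<in> nodes s'" and e: "e \<in> cmatch s'"
      have BF: "B \<in> family s" "B \<notin> D" using B by (auto simp: nodes_def maximal_sets_def same)
      show "\<not> e \<subseteq> B"
      proof (cases "e \<in> cmatch s")
        case True
        then show ?thesis using cmatch_not_inside BF by blast
      next
        case False
        then obtain U where U: "U \<in> D" "e \<in> near s U" using e by (auto simp: same)
        have Ub: "U \<in> blossoms s" using U D_bl by blast
        show ?thesis
        proof
          assume sub: "e \<subseteq> B"
          have "e \<noteq> {}" using tight_edge(3) cycle_tight[OF Ub] near_subset_cycle[OF Ub] U(2) by fastforce
          then have "B \<subseteq> U" using node_contains_member[OF D_node[OF U(1)] BF(1)] near_inside[OF Ub U(2)] sub by blast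
          then have "B \<subset> U" using U BF by blast
          then show False using near_not_inside[OF Ub U(2) BF(1)] sub by blast
        qed
      qed
      fix f assume f: "f \<in> cmatch s'" and h: "e \<inter> B \<noteq> {}" "f \<inter> B \<noteq> {}"
      show "e = f"
        using nodes'[OF B]
      proof
        assume BN: "B \<in> nodes s - D"
        have "g \<in> cmatch s" if g: "g \<in> cmatch s'" "g \<inter> B \<noteq> {}" for g
        proof (rule ccontr)
          assume "g \<notin> cmatch s"
          then obtain U where U: "U \<in> D" "g \<in> near s U" using g by (auto simp: same)
          then have "g \<subseteq> U" using near_inside D_bl by blast
          then have "U = B" using nodes_eq[OF D_node[OF U(1)]] BN g(2) by blast
          then show False using U BN by blast
        qed
        then show ?thesis using node_matching_unique[OF cmatch_node_matching] BN e f h by blast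
      next
        assume "\<exists>U\<in>D. B \<in> cycle_nodes s U"
        then obtain U where U: "U \<in> D" "B \<in> cycle_nodes s U" by blast
        have Ub: "U \<in> blossoms s" using U D_bl by blast
        have BU: "B \<subseteq> U" using cycle_nodes_in_family(2)[OF U(2)] by blast
        have hU: "g \<inter> U \<noteq> {}" if "g \<inter> B \<noteq> {}" for g using BU that by blast
        have mixed: False if g: "g \<in> cmatch s" "g \<inter> B \<noteq> {}" and h: "h \<in> near s U" "h \<inter> B \<noteq> {}" for g h
        proof -
          have "g \<in> tight_edges V E w s" using g cmatch_tight by blast
          then have "g \<in> cut E U"
            using edge_crosses[OF _ hU[OF g(2)] cmatch_not_inside[OF g(1) blossom_in_family[OF Ub]]] tight_edge
            by (simp add: cut_def)
          then have "uncovered (near s U) B"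
            using leaving_edge_base[OF Ub _ _ U(2) g(2)] g(1) by (simp add: full_matching_def)
          then show False using h by (auto simp: uncovered_def)
        qed
        consider "e \<in> cmatch s" "f \<in> cmatch s" | "e \<in> near s U" "f \<in> near s U"
          using D_part[OF e hU[OF h(1)] U(1)] D_part[OF f hU[OF h(2)] U(1)] mixed h by blast
        then show ?thesis
        proof cases
          case 1
          then show ?thesis
            using node_matching_unique[OF cmatch_node_matching D_node[OF U(1)] _ _ hU[OF h(1)] hU[OF h(2)]] by blast
        next
          case 2
          then show ?thesis using node_matching_unique[OF near_node_matching[OF Ub] U(2) _ _ h] by blast
        qed
      qed
    qed
    fix U assume "U \<in> blossoms s'"
    then have U: "U \<in> blossoms s" by (simp add: same)
    have cU: "cycle_nodes s' U = cycle_nodes s U" using cyc[OF blossom_in_family[OF U]] .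
    show "cycle s' U \<subseteq> tight_edges V E w s'" using tight_cycle[OF U] by (simp add: same)
    show "e \<subseteq> U" if "e \<in> cycle s' U" for e using cycle_inside[OF U] that by (simp add: same)
    show "near s' U \<subseteq> cycle s' U" using near_subset_cycle[OF U] by (simp add: same)
    show "node_matching (cycle_nodes s' U) (near s' U)" using near_node_matching[OF U] by (simp add: same cU)
    show "W = W'" if "W \<in> cycle_nodes s' U" "W' \<in> cycle_nodes s' U" "uncovered (near s' U) W" "uncovered (near s' U) W'" for W W'
      using near_misses_one[OF U] that by (simp add: same cU)
    show "uncovered (near s' U) W" if "e \<in> full_matching s'" "e \<in> cut E U" "W \<in> cycle_nodes s' U" "e \<inter> W \<noteq> {}" for e W
      using leaving_edge_base[OF U _ that(2) _ that(4)] that(1,3) by (simp add: same(5) cU full)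
  qed (rule graph)
qed

end

context blossom_state
begin

text \<open>The hypothesis gives the amount \<open>\<delta>\<close> for outer nodes only. An inner
  node moves by the amount of its root, and roots are exposed, hence outer; so the same
  \<open>\<delta>\<close> applies to it.\<close>

lemma dual_step_preserves:
  assumes step: "dual_step V E w s s'"
    and \<delta>: "\<forall>U\<in>outer_nodes V E w s. dual s' U = dual s U + \<delta>"
    and pot: "exposed_potential_maximal V s c"
  shows "blossom_state V E w s'" "exposed_potential_maximal V s' (c + \<delta>)"
proof -
  obtain r d \<alpha> where none: "\<nexists>Us es. exposed_walk V E w s Us es"
    and trees: "alternating_trees V E w s r"
    and d: "\<forall>x\<in>exposed_nodes s. 0 \<le> d x" "\<exists>x\<in>exposed_nodes s. 0 < d x" "0 \<le> \<alpha>"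
    and feas: "dual_feasible V E w (shifted_dual V E w s (\<lambda>U. \<alpha> * d (r U)))"
    and s'0: "let y = shifted_dual V E w s (\<lambda>U. \<alpha> * d (r U));
             D = {U \<in> nodes s. 3 \<le> card U \<and> y U = 0}
         in s' = s\<lparr>family := family s - D, dual := y, cmatch := cmatch s \<union> \<Union> (near s ` D)\<rparr>"
    using step unfolding dual_step_def by (elim exE conjE) (rule that)
  define y where "y = shifted_dual V E w s (\<lambda>U. \<alpha> * d (r U))"
  define D where "D = {U \<in> nodes s. 3 \<le> card U \<and> y U = 0}"
  have s': "s' = s\<lparr>family := family s - D, dual := y, cmatch := cmatch s \<union> \<Union> (near s ` D)\<rparr>"
    using s'0 by (simp add: Let_def y_def D_def)
  have outer: "\<alpha> * d (r U) = \<delta>" if "U \<in> outer_nodes V E w s" for U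
    using \<delta> that by (simp add: s' y_def shifted_dual_def)
  \<comment> \<open>The tree path to \<open>U\<close> starts at \<open>r U\<close> and all its nodes
    have the same root, so \<open>r U\<close> is its own root.\<close>
  have root: "r U \<in> exposed_nodes s \<and> r (r U) = r U" if U: "U \<in> outer_nodes V E w s \<union> inner_nodes V E w s" for U
  proof -
    have "r U \<in> exposed_nodes s \<and> (\<exists>Us es. alt_walk V E w s Us es \<and> distinct Us \<and> hd Us = r U \<and> last Us = U \<and>
                 (\<forall>W\<in>set Us. r W = r U))"
      using trees U unfolding alternating_trees_def by (rule bspec)
    then obtain Us es where a: "alt_walk V E w s Us es" "hd Us = r U" "\<forall>W\<in>set Us. r W = r U" and ex: "r U \<in> exposed_nodes s"
      by (elim exE conjE) (rule that)
    have "Us \<noteq> []" using a(1) walk_length by (force simp: alt_walk_def)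
    then show ?thesis using a ex hd_in_set by metis
  qed
  have amount: "\<alpha> * d (r U) = \<delta>" if U: "U \<in> outer_nodes V E w s \<union> inner_nodes V E w s" for U
    using root[OF U] outer[of "r U"] exposed_subset_outer by auto
  interpret dual_change V E w s y \<delta>
  proof
    \<comment> \<open>The sign of \<open>\<delta>\<close> comes from an exposed node: there
      \<open>\<delta>\<close> is \<open>\<alpha>\<close> times the nonnegative rate of its
      root.\<close>
    obtain x where x: "x \<in> exposed_nodes s" using d(2) by blast
    then have "x \<in> outer_nodes V E w s" using exposed_subset_outer by blast
    then show "0 \<le> \<delta>" using outer[of x] root[of x] d(1,3) by (metis UnI1 mult_nonneg_nonneg)
    fix U
    show "y U = dual s U + \<delta>" if "U \<in> outer_nodes V E w s" using that amount[of U] by (simp add: y_def shifted_dual_def)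
    show "y U = dual s U - \<delta>" if "U \<in> inner_nodes V E w s"
      using that amount[of U] outer_inner_disjoint[OF none, of U] by (auto simp: y_def shifted_dual_def)
    show "y U = dual s U" if "U \<notin> outer_nodes V E w s" "U \<notin> inner_nodes V E w s"
      using that by (simp add: y_def shifted_dual_def)
  qed
  have "dual_feasible V E w y" using feas by (simp add: y_def)
  note ds = deshrink_preserves[OF this D_def s']
  show "blossom_state V E w s'" by (rule ds)
  have "dual s' = y" by (simp add: s')
  then show "exposed_potential_maximal V s' (c + \<delta>)"
    using pot potential_change_le potential_change_exposed ds(2) by (fastforce simp: exposed_potential_maximal_def)
qed

end

section \<open>Induction along the run\<close>

lemma blossom_state_run:
  assumes G: "simple_graph V E" and run: "edmonds_run V E w s n" and \<beta>: "\<forall>v\<in>V. dual (s 0) {v} = \<beta>"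
    and unif: "\<forall>i<n. dual_step V E w (s i) (s (Suc i)) \<longrightarrow>
           (\<exists>\<delta>. \<forall>U\<in>outer_nodes V E w (s i). dual (s (Suc i)) U = dual (s i) U + \<delta>)"
    and i: "i \<le> n"
  shows "blossom_state V E w (s i) \<and> (\<exists>c. exposed_potential_maximal V (s i) c)"
  using i
proof (induction i)
  case 0
  have "edmonds_init V E w (s 0)" using run by (simp add: edmonds_run_def)
  then show ?case using blossom_state_init[OF G] exposed_potential_maximal_init[OF G _ \<beta>] by blast
next
  case (Suc i)
  then obtain c where st: "blossom_state V E w (s i)" and c: "exposed_potential_maximal V (s i) c" by auto
  interpret blossom_state V E w "s i" by (rule st)
  have "edmonds_iteration V E w (s i) (s (Suc i))" using run Suc.prems by (simp add: edmonds_run_def)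
  then consider "augment_step V E w (s i) (s (Suc i))" | "shrink_step V E w (s i) (s (Suc i))"
    | "dual_step V E w (s i) (s (Suc i))"
    unfolding edmonds_iteration_def by blast
  then show ?case
  proof cases
    case 1
    have "exposed_potential_maximal V (s (Suc i)) c"
      using c augment_preserves(2,3)[OF 1] unfolding exposed_potential_maximal_def by auto
    then show ?thesis using augment_preserves(1)[OF 1] by blast
  next
    case 2
    have "exposed_potential_maximal V (s (Suc i)) c"
      using c shrink_preserves(2,3)[OF 2] unfolding exposed_potential_maximal_def by simp
    then show ?thesis using shrink_preserves(1)[OF 2] by blast
  next
    case 3
    have "i < n" using Suc.prems by simp
    then have "\<exists>\<delta>. \<forall>U\<in>outer_nodes V E w (s i). dual (s (Suc i)) U = dual (s i) U + \<delta>" using unif 3 by blast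
    then obtain \<delta> where "\<forall>U\<in>outer_nodes V E w (s i). dual (s (Suc i)) U = dual (s i) U + \<delta>" ..
    then show ?thesis using dual_step_preserves[OF 3 _ c] by blast
  qed
qed

theorem theorem7:
  fixes V :: "'v set" and E :: "'v set set" and w :: "'v set \<Rightarrow> real"
    and s :: "nat \<Rightarrow> 'v state" and n :: nat and \<beta> :: real
  assumes "simple_graph V E"
    and "\<forall>e\<in>E. 0 \<le> w e"
    and "edmonds_run V E w s n"
    and "\<forall>U\<in>odd_sets V. 3 \<le> card U \<longrightarrow> dual (s 0) U = 0"
    and "\<forall>v\<in>V. dual (s 0) {v} = \<beta>"
    and "\<forall>i<n. dual_step V E w (s i) (s (Suc i)) \<longrightarrow>
           (\<exists>\<delta>. \<forall>U\<in>outer_nodes V E w (s i). dual (s (Suc i)) U = dual (s i) U + \<delta>)"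
  shows "\<forall>i\<le>n. cardinality_optimal E w (full_matching (s i))"
proof (intro allI impI)
  fix i assume "i \<le> n"
  then obtain c where st: "blossom_state V E w (s i)" and c: "exposed_potential_maximal V (s i) c"
    using blossom_state_run[OF assms(1,3,5,6)] by blast
  show "cardinality_optimal E w (full_matching (s i))"
    by (rule blossom_state.optimal_if_exposed_potential_maximal[OF st, of c])
      (use c in \<open>auto simp: exposed_potential_maximal_def\<close>)
qed

end
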